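(* Let $G$ be a countable directed graph. If $\lambda$ is a left-bounded left weight on $G$ and $\rho$ is its canonical right companion, then the commutant of $\mathfrak{L}(G,\lambda)$ in $\mathcal{B}(\mathcal{H}_G)$ coincides with $\mathfrak{R}(G,\rho)$, i.e. $\mathfrak{L}(G,\lambda)'=\mathfrak{R}(G,\rho)$.
   Context: $G$ is a countable directed graph (multiple edges and loops allowed) with vertex set $V(G)$ and edge set $E(G)$. $G^+$ is the set of all finite directed paths in $G$, including the vertices as paths of length $0$; $s(w)$, $r(w)$ are the source and range vertices of a path $w$, with $s(x)=r(x)=x$ for $x\in V(G)$. Paths are composed right to left: $w=r(w)\,w\,s(w)$, and for $v,w\in G^+$ one has $wv\in G^+$ if and only if $s(w)=r(v)$. $\mathcal{H}_G=\ell^2(G^+)$ with canonical orthonormal basis $\{\xi_v : v\in G^+\}$. A left weight on $G$ is a function $\lambda: G^+\times G^+\to[0,\infty)$ such that $\lambda(v,w)>0\iff wv\in G^+$, and $\lambda(v,w_2w_1)=\lambda(w_1v,w_2)\lambda(v,w_1)$ whenever $w_2w_1v\in G^+$. Put $\lambda(w)=\sup_{v\in G^+}\lambda(v,w)\in[0,\infty]$. $\lambda$ is left-bounded if $\lambda(w)<\infty$ for all $w\in G^+$. If $\lambda(w)<\infty$, $L_{\lambda,w}\in\mathcal{B}(\mathcal{H}_G)$ is the bounded operator with $L_{\lambda,w}\xi_v=\lambda(v,w)\xi_{wv}$ if $wv\in G^+$ and $L_{\lambda,w}\xi_v=0$ otherwise. $\mathfrak{L}(G,\lambda)$ is the WOT-closed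 unital operator algebra generated by $\{L_{\lambda,w}: w\in G^+,\ \lambda(w)<\infty\}$. A right weight on $G$ is a function $\rho:G^+\times G^+\to[0,\infty)$ such that $\rho(v,u)>0\iff vu\in G^+$, and $\rho(v,u_1u_2)=\rho(vu_1,u_2)\rho(v,u_1)$ whenever $vu_1u_2\in G^+$. Put $\rho(u)=\sup_{v\in G^+}\rho(v,u)\in[0,\infty]$. If $\rho(u)<\infty$, $R_{\rho,u}\in\mathcal{B}(\mathcal{H}_G)$ is the bounded operator with $R_{\rho,u}\xi_v=\rho(v,u)\xi_{vu}$ if $vu\in G^+$ and $R_{\rho,u}\xi_v=0$ otherwise. $\mathfrak{R}(G,\rho)$ is the WOT-closed unital operator algebra generated by $\{R_{\rho,u}: u\in G^+,\ \rho(u)<\infty\}$. A right weight $\rho$ is a right companion to $\lambda$ if $\rho(wv,u)\lambda(v,w)=\lambda(vu,w)\rho(v,u)$ for all $v,w,u\in G^+$ with $wvu\in G^+$. It is canonical if moreover $\rho(r(e),e)=\lambda(s(e),e)$ for all $e\in E(G)$. Every left weight has exactly one canonical right companion. *)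

theory Defs
  imports "HOL-Analysis.Analysis" "Graph_Theory.Arc_Walk"
begin

section \<open>The Hilbert space of square-summable families and its bounded operators\<close>

text \<open>
  The space \<open>\<ell>\<^sup>2(A)\<close> of a subset \<open>A\<close> of a type consists of the square-summable complex families
  on \<open>A\<close>, extended by zero to the whole type. The extension makes equality of
  vectors equality of functions.
\<close>

definition ell2 :: "'p set \<Rightarrow> ('p \<Rightarrow> complex) set" where
  "ell2 A = {f. (\<forall>x. x \<notin> A \<longrightarrow> f x = 0) \<and> (\<lambda>x. (cmod (f x))\<^sup>2) summable_on UNIV}"

definition ell2_norm :: "('p \<Rightarrow> complex) \<Rightarrow> real" where
  "ell2_norm f = sqrt (\<Sum>\<^sub>\<infinity>x. (cmod (f x))\<^sup>2)"

definition ell2_inner :: "('p \<Rightarrow> complex) \<Rightarrow> ('p \<Rightarrow> complex) \<Rightarrow> complex" where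
  "ell2_inner f g = (\<Sum>\<^sub>\<infinity>x. f x * cnj (g x))"

definition ket :: "'p \<Rightarrow> 'p \<Rightarrow> complex" where
  "ket v = (\<lambda>x. if x = v then 1 else 0)"

text \<open>
  Operators are extensional functions on the carrier \<open>\<ell>\<^sup>2(A)\<close> (undefined outside), so that
  two bounded operators are equal iff they are equal as functions; accordingly their
  sum, scalar multiples and composition are restricted to the carrier.
\<close>

definition bounded_ops :: "'p set \<Rightarrow> (('p \<Rightarrow> complex) \<Rightarrow> ('p \<Rightarrow> complex)) set" where
  "bounded_ops A = {T \<in> ell2 A \<rightarrow>\<^sub>E ell2 A.
     (\<forall>f\<in>ell2 A. \<forall>g\<in>ell2 A. T (\<lambda>x. f x + g x) = (\<lambda>x. T f x + T g x)) \<and>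
     (\<forall>c. \<forall>f\<in>ell2 A. T (\<lambda>x. c * f x) = (\<lambda>x. c * T f x)) \<and>
     (\<exists>C. \<forall>f\<in>ell2 A. ell2_norm (T f) \<le> C * ell2_norm f)}"

definition wot :: "'p set \<Rightarrow> (('p \<Rightarrow> complex) \<Rightarrow> ('p \<Rightarrow> complex)) topology" where
  "wot A = topology_generated_by
     {{T \<in> bounded_ops A. ell2_inner (T f) g \<in> U} | f g U. f \<in> ell2 A \<and> g \<in> ell2 A \<and> open U}"

definition unital_subalgebra ::
  "'p set \<Rightarrow> (('p \<Rightarrow> complex) \<Rightarrow> ('p \<Rightarrow> complex)) set \<Rightarrow> bool" where
  "unital_subalgebra A M \<longleftrightarrow>
     M \<subseteq> bounded_ops A \<and>
     (\<lambda>f\<in>ell2 A. f) \<in> M \<and>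
     (\<forall>S\<in>M. \<forall>T\<in>M. (\<lambda>f\<in>ell2 A. \<lambda>x. S f x + T f x) \<in> M) \<and>
     (\<forall>c. \<forall>T\<in>M. (\<lambda>f\<in>ell2 A. \<lambda>x. c * T f x) \<in> M) \<and>
     (\<forall>S\<in>M. \<forall>T\<in>M. compose (ell2 A) S T \<in> M)"

definition wot_algebra_generated ::
  "'p set \<Rightarrow> (('p \<Rightarrow> complex) \<Rightarrow> ('p \<Rightarrow> complex)) set \<Rightarrow> (('p \<Rightarrow> complex) \<Rightarrow> ('p \<Rightarrow> complex)) set" where
  "wot_algebra_generated A X =
     \<Inter> {M. unital_subalgebra A M \<and> closedin (wot A) M \<and> X \<subseteq> M}"

definition commutant ::
  "'p set \<Rightarrow> (('p \<Rightarrow> complex) \<Rightarrow> ('p \<Rightarrow> complex)) set \<Rightarrow> (('p \<Rightarrow> complex) \<Rightarrow> ('p \<Rightarrow> complex)) set" where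
  "commutant A M =
     {T \<in> bounded_ops A. \<forall>S\<in>M. compose (ell2 A) T S = compose (ell2 A) S T}"


section \<open>Finite directed paths\<close>

text \<open>
  A path is a triple (source, list of arcs, range). The list is in the order of traversal,
  i.e. reversed with respect to the right-to-left notation: the path \<open>e\<^sub>n \<cdots> e\<^sub>1\<close> has the arc
  list \<open>[e\<^sub>1, \<dots>, e\<^sub>n]\<close>. The source of an arc is its tail, the range its head.
\<close>

type_synonym ('a, 'b) dpath = "'a \<times> 'b list \<times> 'a"

definition dpaths :: "('a, 'b) pre_digraph \<Rightarrow> ('a, 'b) dpath set" where
  "dpaths G = {(x, p, y). pre_digraph.awalk G x p y}"

definition source :: "('a, 'b) dpath \<Rightarrow> 'a" where
  "source w = fst w"

definition range_of :: "('a, 'b) dpath \<Rightarrow> 'a" where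
  "range_of w = snd (snd w)"

definition vertex_path :: "'a \<Rightarrow> ('a, 'b) dpath" where
  "vertex_path x = (x, [], x)"

definition edge_path :: "('a, 'b) pre_digraph \<Rightarrow> 'b \<Rightarrow> ('a, 'b) dpath" where
  "edge_path G e = (tail G e, [e], head G e)"

text \<open>\<open>w \<cdot> v\<close> is ``first \<open>v\<close>, then \<open>w\<close>''; it is meaningful only if \<open>source w = range_of v\<close>.\<close>

definition pcomp :: "('a, 'b) dpath \<Rightarrow> ('a, 'b) dpath \<Rightarrow> ('a, 'b) dpath" (infixr "\<cdot>" 75) where
  "w \<cdot> v = (source v, fst (snd v) @ fst (snd w), range_of w)"

text \<open>
  For paths \<open>v, w\<close> being composable is the same as \<open>w \<cdot> v\<close> being a path. For three
  factors this fails (the middle one may be a vertex foreign to the other two, which the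
  formal composition forgets), hence products of three paths below are guarded by
  both composability conditions.
\<close>

lemma pcomp_in_dpaths_iff:
  assumes "v \<in> dpaths G" "w \<in> dpaths G"
  shows "w \<cdot> v \<in> dpaths G \<longleftrightarrow> source w = range_of v"
proof -
  interpret pre_digraph G .
  obtain x p y where v: "v = (x, p, y)" by (cases v)
  obtain x' q z where w: "w = (x', q, z)" by (cases w)
  have v': "x \<in> verts G" "set p \<subseteq> arcs G" "cas x p y"
    and w': "x' \<in> verts G" "set q \<subseteq> arcs G" "cas x' q z"
    using assms by (auto simp: v w dpaths_def awalk_def)
  have "cas x p y \<longrightarrow> awlast x p = y"
    by (induct p arbitrary: x) auto
  then have last: "awlast x p = y" using v'(3) by simp
  have "x' = y" if "cas y q z" using that w'(3) by (cases q) auto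
  then show ?thesis
    using v' w' by (auto simp: v w dpaths_def awalk_def pcomp_def source_def range_of_def last)
qed

lemma pcomp_inj_left: "source w = range_of v \<Longrightarrow> source w = range_of v' \<Longrightarrow> w \<cdot> v = w \<cdot> v' \<Longrightarrow> v = v'"
  by (cases v; cases v') (auto simp: pcomp_def source_def range_of_def)

lemma pcomp_inj_right: "source v = range_of u \<Longrightarrow> source v' = range_of u \<Longrightarrow> v \<cdot> u = v' \<cdot> u \<Longrightarrow> v = v'"
  by (cases v; cases v') (auto simp: pcomp_def source_def range_of_def)


section \<open>Weights\<close>

text \<open>Weights matter only on pairs of paths; their values elsewhere are left unconstrained.\<close>

definition left_weight ::
  "('a, 'b) pre_digraph \<Rightarrow> (('a, 'b) dpath \<Rightarrow> ('a, 'b) dpath \<Rightarrow> real) \<Rightarrow> bool" where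
  "left_weight G lam \<longleftrightarrow>
     (\<forall>v\<in>dpaths G. \<forall>w\<in>dpaths G. lam v w \<ge> 0 \<and> (lam v w > 0 \<longleftrightarrow> source w = range_of v)) \<and>
     (\<forall>v\<in>dpaths G. \<forall>w1\<in>dpaths G. \<forall>w2\<in>dpaths G.
        source w2 = range_of w1 \<and> source w1 = range_of v \<longrightarrow>
        lam v (w2 \<cdot> w1) = lam (w1 \<cdot> v) w2 * lam v w1)"

definition right_weight ::
  "('a, 'b) pre_digraph \<Rightarrow> (('a, 'b) dpath \<Rightarrow> ('a, 'b) dpath \<Rightarrow> real) \<Rightarrow> bool" where
  "right_weight G rho \<longleftrightarrow>
     (\<forall>v\<in>dpaths G. \<forall>u\<in>dpaths G. rho v u \<ge> 0 \<and> (rho v u > 0 \<longleftrightarrow> source v = range_of u)) \<and>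
     (\<forall>v\<in>dpaths G. \<forall>u1\<in>dpaths G. \<forall>u2\<in>dpaths G.
        source v = range_of u1 \<and> source u1 = range_of u2 \<longrightarrow>
        rho v (u1 \<cdot> u2) = rho (v \<cdot> u1) u2 * rho v u1)"

text \<open>\<open>\<lambda>(w) = sup\<^sub>v \<lambda>(v,w)\<close>, respectively \<open>\<rho>(u) = sup\<^sub>v \<rho>(v,u)\<close>, in \<open>[0,\<infinity>]\<close>.\<close>

definition weight_sup ::
  "('a, 'b) pre_digraph \<Rightarrow> (('a, 'b) dpath \<Rightarrow> ('a, 'b) dpath \<Rightarrow> real) \<Rightarrow> ('a, 'b) dpath \<Rightarrow> ennreal" where
  "weight_sup G lam w = (SUP v\<in>dpaths G. ennreal (lam v w))"

definition left_bounded ::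
  "('a, 'b) pre_digraph \<Rightarrow> (('a, 'b) dpath \<Rightarrow> ('a, 'b) dpath \<Rightarrow> real) \<Rightarrow> bool" where
  "left_bounded G lam \<longleftrightarrow> (\<forall>w\<in>dpaths G. weight_sup G lam w < \<infinity>)"

definition right_companion ::
  "('a, 'b) pre_digraph \<Rightarrow> (('a, 'b) dpath \<Rightarrow> ('a, 'b) dpath \<Rightarrow> real) \<Rightarrow>
   (('a, 'b) dpath \<Rightarrow> ('a, 'b) dpath \<Rightarrow> real) \<Rightarrow> bool" where
  "right_companion G lam rho \<longleftrightarrow>
     right_weight G rho \<and>
     (\<forall>v\<in>dpaths G. \<forall>w\<in>dpaths G. \<forall>u\<in>dpaths G.
        source w = range_of v \<and> source v = range_of u \<longrightarrow>
        rho (w \<cdot> v) u * lam v w = lam (v \<cdot> u) w * rho v u)"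

definition canonical_right_companion ::
  "('a, 'b) pre_digraph \<Rightarrow> (('a, 'b) dpath \<Rightarrow> ('a, 'b) dpath \<Rightarrow> real) \<Rightarrow>
   (('a, 'b) dpath \<Rightarrow> ('a, 'b) dpath \<Rightarrow> real) \<Rightarrow> bool" where
  "canonical_right_companion G lam rho \<longleftrightarrow>
     right_companion G lam rho \<and>
     (\<forall>e\<in>arcs G. rho (vertex_path (head G e)) (edge_path G e)
                 = lam (vertex_path (tail G e)) (edge_path G e))"


section \<open>Weighted creation operators and their algebras\<close>

definition L_op ::
  "('a, 'b) pre_digraph \<Rightarrow> (('a, 'b) dpath \<Rightarrow> ('a, 'b) dpath \<Rightarrow> real) \<Rightarrow> ('a, 'b) dpath \<Rightarrow>
   (('a, 'b) dpath \<Rightarrow> complex) \<Rightarrow> ('a, 'b) dpath \<Rightarrow> complex" where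
  "L_op G lam w = (THE T. T \<in> bounded_ops (dpaths G) \<and>
     (\<forall>v\<in>dpaths G. T (ket v) =
        (if source w = range_of v then (\<lambda>x. complex_of_real (lam v w) * ket (w \<cdot> v) x) else (\<lambda>x. 0))))"

definition R_op ::
  "('a, 'b) pre_digraph \<Rightarrow> (('a, 'b) dpath \<Rightarrow> ('a, 'b) dpath \<Rightarrow> real) \<Rightarrow> ('a, 'b) dpath \<Rightarrow>
   (('a, 'b) dpath \<Rightarrow> complex) \<Rightarrow> ('a, 'b) dpath \<Rightarrow> complex" where
  "R_op G rho u = (THE T. T \<in> bounded_ops (dpaths G) \<and>
     (\<forall>v\<in>dpaths G. T (ket v) =
        (if source v = range_of u then (\<lambda>x. complex_of_real (rho v u) * ket (v \<cdot> u) x) else (\<lambda>x. 0))))"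

definition left_algebra ::
  "('a, 'b) pre_digraph \<Rightarrow> (('a, 'b) dpath \<Rightarrow> ('a, 'b) dpath \<Rightarrow> real) \<Rightarrow>
   ((('a, 'b) dpath \<Rightarrow> complex) \<Rightarrow> ('a, 'b) dpath \<Rightarrow> complex) set" where
  "left_algebra G lam = wot_algebra_generated (dpaths G)
     {L_op G lam w | w. w \<in> dpaths G \<and> weight_sup G lam w < \<infinity>}"

definition right_algebra ::
  "('a, 'b) pre_digraph \<Rightarrow> (('a, 'b) dpath \<Rightarrow> ('a, 'b) dpath \<Rightarrow> real) \<Rightarrow>
   ((('a, 'b) dpath \<Rightarrow> complex) \<Rightarrow> ('a, 'b) dpath \<Rightarrow> complex) set" where
  "right_algebra G rho = wot_algebra_generated (dpaths G)
     {R_op G rho u | u. u \<in> dpaths G \<and> weight_sup G rho u < \<infinity>}"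


section \<open>The descriptions above are well defined\<close>

lemma ket_in_ell2: "v \<in> A \<Longrightarrow> ket v \<in> ell2 A"
proof -
  assume "v \<in> A"
  moreover have "(\<lambda>x. (cmod (ket v x))\<^sup>2) summable_on UNIV"
    by (rule finite_nonzero_values_imp_summable_on) (simp add: ket_def)
  ultimately show ?thesis by (auto simp: ell2_def ket_def)
qed

lemma zero_in_ell2: "(\<lambda>x. 0) \<in> ell2 A"
  by (simp add: ell2_def)

lemma ell2_scale:
  assumes "f \<in> ell2 A"
  shows "(\<lambda>x. c * f x) \<in> ell2 A"
  using assms by (auto simp: ell2_def norm_mult power_mult_distrib intro!: summable_on_cmult_right)

lemma ell2_add:
  assumes f: "f \<in> ell2 A" and g: "g \<in> ell2 A"
  shows "(\<lambda>x. f x + g x) \<in> ell2 A"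
proof -
  have "(\<lambda>x. 2 * (cmod (f x))\<^sup>2 + 2 * (cmod (g x))\<^sup>2) summable_on UNIV"
    using f g by (auto simp: ell2_def intro!: summable_on_add summable_on_cmult_right)
  moreover have "(cmod (f x + g x))\<^sup>2 \<le> 2 * (cmod (f x))\<^sup>2 + 2 * (cmod (g x))\<^sup>2" for x
  proof -
    have "(cmod (f x + g x))\<^sup>2 \<le> (cmod (f x) + cmod (g x))\<^sup>2"
      by (intro power_mono norm_triangle_ineq) auto
    also have "\<dots> \<le> 2 * (cmod (f x))\<^sup>2 + 2 * (cmod (g x))\<^sup>2"
      using sum_squares_bound[of "cmod (f x)" "cmod (g x)"] by (simp add: power2_sum)
    finally show ?thesis .
  qed
  ultimately have "(\<lambda>x. (cmod (f x + g x))\<^sup>2) summable_on UNIV"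
    by (rule summable_on_comparison_test) auto
  then show ?thesis using f g by (auto simp: ell2_def)
qed

lemma topspace_wot: "topspace (wot A) = bounded_ops A"
proof -
  have "{T \<in> bounded_ops A. ell2_inner (T (\<lambda>x. 0)) (\<lambda>x. 0) \<in> UNIV}
     \<in> {{T \<in> bounded_ops A. ell2_inner (T f) g \<in> U} | f g U. f \<in> ell2 A \<and> g \<in> ell2 A \<and> open U}"
    using zero_in_ell2[of A] open_UNIV by blast
  then show ?thesis unfolding wot_def topology_generated_by_topspace by blast
qed

lemma cmod_le_ell2_norm:
  assumes "f \<in> ell2 A"
  shows "cmod (f x) \<le> ell2_norm f"
proof -
  have "(\<Sum>x\<in>{x}. (cmod (f x))\<^sup>2) \<le> (\<Sum>\<^sub>\<infinity>x. (cmod (f x))\<^sup>2)"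
    using assms by (intro finite_sum_le_infsum) (auto simp: ell2_def)
  then show ?thesis unfolding ell2_norm_def by (simp add: real_le_rsqrt)
qed

lemma ell2_finite_restrict:
  assumes "f \<in> ell2 A" "finite F"
  shows "(\<lambda>x. if x \<in> F then f x else 0) \<in> ell2 A"
proof -
  have "(\<lambda>x. (cmod (if x \<in> F then f x else 0))\<^sup>2) summable_on UNIV"
    by (rule finite_nonzero_values_imp_summable_on)
       (rule finite_subset[OF _ assms(2)], auto split: if_splits)
  then show ?thesis using assms by (auto simp: ell2_def)
qed

lemma bounded_ops_add:
  "R \<in> bounded_ops A \<Longrightarrow> f \<in> ell2 A \<Longrightarrow> g \<in> ell2 A \<Longrightarrow> R (\<lambda>x. f x + g x) = (\<lambda>x. R f x + R g x)"
  by (simp add: bounded_ops_def)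

lemma bounded_ops_scale:
  "R \<in> bounded_ops A \<Longrightarrow> f \<in> ell2 A \<Longrightarrow> R (\<lambda>x. c * f x) = (\<lambda>x. c * R f x)"
  by (simp add: bounded_ops_def)

lemma bounded_ops_eqI:
  assumes S: "S \<in> bounded_ops A" and T: "T \<in> bounded_ops A"
    and eq: "\<And>v. v \<in> A \<Longrightarrow> S (ket v) = T (ket v)"
  shows "S = T"
proof (rule extensionalityI[where A = "ell2 A"])
  show "S \<in> extensional (ell2 A)" "T \<in> extensional (ell2 A)"
    using S T by (auto simp: bounded_ops_def PiE_def)
  have zero: "R (\<lambda>x. 0) = (\<lambda>x. 0)" if "R \<in> bounded_ops A" for R
    using bounded_ops_scale[OF that zero_in_ell2, of 0] by simp
  fix f assume f: "f \<in> ell2 A"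
  let ?r = "\<lambda>F x. if x \<in> F then f x else 0"
  have fin: "S (?r F) = T (?r F)" if "finite F" for F
    using that
  proof (induction F rule: finite_induct)
    case empty
    then show ?case using zero[OF S] zero[OF T] by simp
  next
    case (insert v F)
    show ?case
    proof (cases "v \<in> A")
      case False
      then have "?r (insert v F) = ?r F" using f by (auto simp: ell2_def)
      then show ?thesis using insert by simp
    next
      case True
      have dec: "?r (insert v F) = (\<lambda>x. (\<lambda>x. f v * ket v x) x + ?r F x)"
        using insert by (auto simp: ket_def)
      have k: "ket v \<in> ell2 A" "(\<lambda>x. f v * ket v x) \<in> ell2 A" "?r F \<in> ell2 A"
        using ket_in_ell2[OF True] ell2_scale[OF ket_in_ell2[OF True]]
          ell2_finite_restrict[OF f insert(1)] by auto
      have lin: "R (?r (insert v F)) = (\<lambda>x. f v * R (ket v) x + R (?r F) x)"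
        if R: "R \<in> bounded_ops A" for R
      proof -
        have "R (?r (insert v F)) = (\<lambda>x. R (\<lambda>x. f v * ket v x) x + R (?r F) x)"
          unfolding dec by (rule bounded_ops_add[OF R k(2,3)])
        moreover have "R (\<lambda>x. f v * ket v x) = (\<lambda>x. f v * R (ket v) x)"
          by (rule bounded_ops_scale[OF R k(1)])
        ultimately show ?thesis by simp
      qed
      show ?thesis unfolding lin[OF S] lin[OF T] eq[OF True] insert.IH ..
    qed
  qed
  have lim: "((\<lambda>F. R (?r F) u) \<longlongrightarrow> R f u) (finite_subsets_at_top UNIV)"
    if R: "R \<in> bounded_ops A" for R u
  proof -
    obtain C where C: "\<And>g. g \<in> ell2 A \<Longrightarrow> ell2_norm (R g) \<le> C * ell2_norm g"
      using R unfolding bounded_ops_def by blast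
    let ?d = "\<lambda>F x. if x \<in> F then 0 else f x"
    have sm: "(\<lambda>x. (cmod (f x))\<^sup>2) summable_on UNIV"
      using f by (simp add: ell2_def)
    have d: "?d F \<in> ell2 A" if "finite F" for F
      using ell2_add[OF f ell2_scale[OF ell2_finite_restrict[OF f that], of "-1"]]
      by (rule back_subst[of "\<lambda>g. g \<in> ell2 A"]) auto
    have nd: "ell2_norm (?d F) = sqrt ((\<Sum>\<^sub>\<infinity>x. (cmod (f x))\<^sup>2) - (\<Sum>x\<in>F. (cmod (f x))\<^sup>2))"
      if "finite F" for F
    proof -
      have "(\<Sum>\<^sub>\<infinity>x. (cmod (?d F x))\<^sup>2) = (\<Sum>\<^sub>\<infinity>x\<in>UNIV - F. (cmod (f x))\<^sup>2)"
        by (rule infsum_cong_neutral) auto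
      also have "\<dots> = (\<Sum>\<^sub>\<infinity>x. (cmod (f x))\<^sup>2) - (\<Sum>\<^sub>\<infinity>x\<in>F. (cmod (f x))\<^sup>2)"
        using sm that by (intro infsum_Diff) auto
      finally show ?thesis using that by (simp add: ell2_norm_def)
    qed
    have "((\<lambda>F. \<Sum>x\<in>F. (cmod (f x))\<^sup>2) \<longlongrightarrow> (\<Sum>\<^sub>\<infinity>x. (cmod (f x))\<^sup>2)) (finite_subsets_at_top UNIV)"
      using sm by (rule infsum_tendsto)
    then have "((\<lambda>F. C * sqrt ((\<Sum>\<^sub>\<infinity>x. (cmod (f x))\<^sup>2) - (\<Sum>x\<in>F. (cmod (f x))\<^sup>2)))
        \<longlongrightarrow> C * sqrt ((\<Sum>\<^sub>\<infinity>x. (cmod (f x))\<^sup>2) - (\<Sum>\<^sub>\<infinity>x. (cmod (f x))\<^sup>2))) (finite_subsets_at_top UNIV)"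
      by (intro tendsto_intros)
    then have to0: "((\<lambda>F. C * sqrt ((\<Sum>\<^sub>\<infinity>x. (cmod (f x))\<^sup>2) - (\<Sum>x\<in>F. (cmod (f x))\<^sup>2)))
        \<longlongrightarrow> 0) (finite_subsets_at_top UNIV)" by simp
    have "((\<lambda>F. R (?r F) u - R f u) \<longlongrightarrow> 0) (finite_subsets_at_top UNIV)"
    proof (rule Lim_null_comparison[OF _ to0], rule eventually_finite_subsets_at_top_weakI)
      fix F :: "'a set" assume F: "finite F"
      have split: "f = (\<lambda>x. ?r F x + ?d F x)" by auto
      have "R (\<lambda>x. ?r F x + ?d F x) = (\<lambda>x. R (?r F) x + R (?d F) x)"
        by (rule bounded_ops_add[OF R ell2_finite_restrict[OF f F] d[OF F]])
      then have "R f = (\<lambda>x. R (?r F) x + R (?d F) x)" using split by simp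
      then have "norm (R (?r F) u - R f u) = cmod (R (?d F) u)" by simp
      also have "\<dots> \<le> ell2_norm (R (?d F))"
        using R d[OF F] by (intro cmod_le_ell2_norm[of _ A]) (auto simp: bounded_ops_def)
      also have "\<dots> \<le> C * ell2_norm (?d F)" using d[OF F] by (rule C)
      finally show "norm (R (?r F) u - R f u)
          \<le> C * sqrt ((\<Sum>\<^sub>\<infinity>x. (cmod (f x))\<^sup>2) - (\<Sum>x\<in>F. (cmod (f x))\<^sup>2))"
        by (simp add: nd[OF F])
    qed
    then show ?thesis by (simp add: LIM_zero_iff)
  qed
  show "S f = T f"
  proof
    fix u
    have "\<forall>\<^sub>F F in finite_subsets_at_top UNIV. S (?r F) u = T (?r F) u"
      by (rule eventually_finite_subsets_at_top_weakI) (simp add: fin)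
    then have "((\<lambda>F. T (?r F) u) \<longlongrightarrow> S f u) (finite_subsets_at_top UNIV)"
      using lim[OF S] by (rule Lim_transform_eventually[rotated])
    then show "S f u = T f u"
      using lim[OF T] by (intro tendsto_unique[OF finite_subsets_at_top_neq_bot])
  qed
qed

lemma weighted_shift_ex1:
  fixes m :: "'p \<Rightarrow> 'p" and c :: "'p \<Rightarrow> real"
  assumes D: "D \<subseteq> A" and m: "m ` D \<subseteq> A" "inj_on m D"
    and c: "\<And>v. v \<in> D \<Longrightarrow> 0 \<le> c v \<and> c v \<le> C"
  shows "\<exists>!T. T \<in> bounded_ops A \<and>
    (\<forall>v\<in>A. T (ket v) = (if v \<in> D then (\<lambda>x. complex_of_real (c v) * ket (m v) x) else (\<lambda>x. 0)))"
proof (rule ex_ex1I)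
  define i where "i = inv_into D m"
  have i: "i (m v) = v" if "v \<in> D" for v using m(2) that by (simp add: i_def)
  define T0 where "T0 = (\<lambda>f u. if u \<in> m ` D then complex_of_real (c (i u)) * f (i u) else 0)"
  define T where "T = (\<lambda>f\<in>ell2 A. T0 f)"
  have T0: "T0 f \<in> ell2 A \<and> ell2_norm (T0 f) \<le> \<bar>C\<bar> * ell2_norm f" if f: "f \<in> ell2 A" for f
  proof -
    have sm: "(\<lambda>x. (cmod (f x))\<^sup>2) summable_on UNIV" using f by (simp add: ell2_def)
    have smD: "(\<lambda>v. C\<^sup>2 * (cmod (f v))\<^sup>2) summable_on D"
      by (intro summable_on_cmult_right summable_on_subset_banach[OF sm]) auto
    have le: "(c v)\<^sup>2 * (cmod (f v))\<^sup>2 \<le> C\<^sup>2 * (cmod (f v))\<^sup>2" if "v \<in> D" for v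
      using c[OF that] by (intro mult_right_mono power_mono) auto
    have sc: "(\<lambda>v. (c v)\<^sup>2 * (cmod (f v))\<^sup>2) summable_on D"
      by (rule summable_on_comparison_test[OF smD]) (auto intro: le)
    have comp: "(\<lambda>u. (cmod (T0 f u))\<^sup>2) (m v) = (c v)\<^sup>2 * (cmod (f v))\<^sup>2" if "v \<in> D" for v
      using that by (simp add: T0_def i norm_mult power_mult_distrib)
    have "((\<lambda>u. (cmod (T0 f u))\<^sup>2) \<circ> m) summable_on D"
      using sc by (rule summable_on_cong[THEN iffD2, rotated]) (use comp in simp)
    then have s1: "(\<lambda>u. (cmod (T0 f u))\<^sup>2) summable_on m ` D"
      by (simp add: summable_on_reindex[OF m(2)])
    then have s2: "(\<lambda>u. (cmod (T0 f u))\<^sup>2) summable_on UNIV"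
      by (rule summable_on_cong_neutral[THEN iffD1, rotated -1]) (auto simp: T0_def)
    have "(\<Sum>\<^sub>\<infinity>u. (cmod (T0 f u))\<^sup>2) = (\<Sum>\<^sub>\<infinity>u\<in>m ` D. (cmod (T0 f u))\<^sup>2)"
      by (rule infsum_cong_neutral) (auto simp: T0_def)
    also have "\<dots> = (\<Sum>\<^sub>\<infinity>v\<in>D. (c v)\<^sup>2 * (cmod (f v))\<^sup>2)"
      unfolding infsum_reindex[OF m(2)] by (rule infsum_cong) (use comp in simp)
    also have "\<dots> \<le> (\<Sum>\<^sub>\<infinity>v\<in>D. C\<^sup>2 * (cmod (f v))\<^sup>2)"
      by (rule infsum_mono[OF sc smD le])
    also have "\<dots> \<le> (\<Sum>\<^sub>\<infinity>v. C\<^sup>2 * (cmod (f v))\<^sup>2)"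
      by (rule infsum_mono2[OF smD]) (auto intro: summable_on_cmult_right sm)
    also have "\<dots> = C\<^sup>2 * (\<Sum>\<^sub>\<infinity>v. (cmod (f v))\<^sup>2)"
      by (rule infsum_cmult_right) (use sm in simp)
    finally have "sqrt (\<Sum>\<^sub>\<infinity>u. (cmod (T0 f u))\<^sup>2) \<le> sqrt (C\<^sup>2 * (\<Sum>\<^sub>\<infinity>v. (cmod (f v))\<^sup>2))"
      by (rule real_sqrt_le_mono)
    then have "ell2_norm (T0 f) \<le> \<bar>C\<bar> * ell2_norm f"
      by (simp add: ell2_norm_def real_sqrt_mult)
    moreover have "T0 f \<in> ell2 A" using s2 m(1) by (auto simp: ell2_def T0_def)
    ultimately show ?thesis by simp
  qed
  have add: "T0 (\<lambda>x. f x + g x) = (\<lambda>x. T0 f x + T0 g x)" for f g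
    by (auto simp: T0_def algebra_simps)
  have scl: "T0 (\<lambda>x. a * f x) = (\<lambda>x. a * T0 f x)" for a f
    by (auto simp: T0_def algebra_simps)
  have "T \<in> bounded_ops A"
    unfolding bounded_ops_def
  proof (intro CollectI conjI ballI allI)
    show "T \<in> ell2 A \<rightarrow>\<^sub>E ell2 A" using T0 by (auto simp: T_def)
    show "T (\<lambda>x. f x + g x) = (\<lambda>x. T f x + T g x)" if "f \<in> ell2 A" "g \<in> ell2 A" for f g
      using that ell2_add[OF that] by (simp add: T_def add)
    show "T (\<lambda>x. a * f x) = (\<lambda>x. a * T f x)" if "f \<in> ell2 A" for a f
      using that ell2_scale[OF that] by (simp add: T_def scl)
    show "\<exists>C. \<forall>f\<in>ell2 A. ell2_norm (T f) \<le> C * ell2_norm f"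
      using T0 by (intro exI[of _ "\<bar>C\<bar>"]) (simp add: T_def)
  qed
  moreover have "T (ket v) = (if v \<in> D then (\<lambda>x. complex_of_real (c v) * ket (m v) x) else (\<lambda>x. 0))"
    if v: "v \<in> A" for v
  proof
    fix u
    show "T (ket v) u = (if v \<in> D then (\<lambda>x. complex_of_real (c v) * ket (m v) x) else (\<lambda>x. 0)) u"
      using v i ket_in_ell2[OF v] by (auto simp: T_def T0_def ket_def)
  qed
  ultimately show "\<exists>T. T \<in> bounded_ops A \<and>
    (\<forall>v\<in>A. T (ket v) = (if v \<in> D then (\<lambda>x. complex_of_real (c v) * ket (m v) x) else (\<lambda>x. 0)))"
    by blast
next
  fix S T
  assume "S \<in> bounded_ops A \<and>
      (\<forall>v\<in>A. S (ket v) = (if v \<in> D then (\<lambda>x. complex_of_real (c v) * ket (m v) x) else (\<lambda>x. 0)))"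
    and "T \<in> bounded_ops A \<and>
      (\<forall>v\<in>A. T (ket v) = (if v \<in> D then (\<lambda>x. complex_of_real (c v) * ket (m v) x) else (\<lambda>x. 0)))"
  then show "S = T" by (intro bounded_ops_eqI[of S A T]) auto
qed

lemma weight_sup_bound:
  assumes "weight_sup G lam w < \<infinity>"
  obtains C where "\<And>v. v \<in> dpaths G \<Longrightarrow> lam v w \<le> C"
proof
  fix v assume "v \<in> dpaths G"
  then have "ennreal (lam v w) \<le> weight_sup G lam w"
    unfolding weight_sup_def by (rule SUP_upper)
  also have "\<dots> = ennreal (enn2real (weight_sup G lam w))" using assms by simp
  finally show "lam v w \<le> enn2real (weight_sup G lam w)"
    by (simp add: ennreal_le_iff2) (use enn2real_nonneg order_trans in blast)
qed

lemma L_op_ex1: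
  assumes lam: "left_weight G lam" and w: "w \<in> dpaths G" and fin: "weight_sup G lam w < \<infinity>"
  shows "\<exists>!T. T \<in> bounded_ops (dpaths G) \<and>
     (\<forall>v\<in>dpaths G. T (ket v) =
        (if source w = range_of v then (\<lambda>x. complex_of_real (lam v w) * ket (w \<cdot> v) x) else (\<lambda>x. 0)))"
proof -
  obtain C where C: "\<And>v. v \<in> dpaths G \<Longrightarrow> lam v w \<le> C" using weight_sup_bound[OF fin] by blast
  let ?D = "{v \<in> dpaths G. source w = range_of v}"
  have "\<exists>!T. T \<in> bounded_ops (dpaths G) \<and>
     (\<forall>v\<in>dpaths G. T (ket v) =
        (if v \<in> ?D then (\<lambda>x. complex_of_real (lam v w) * ket (w \<cdot> v) x) else (\<lambda>x. 0)))"
  proof (rule weighted_shift_ex1)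
    show "(\<lambda>v. w \<cdot> v) ` ?D \<subseteq> dpaths G" using pcomp_in_dpaths_iff[OF _ w] by blast
    show "inj_on (\<lambda>v. w \<cdot> v) ?D" by (auto intro!: inj_onI dest: pcomp_inj_left)
    show "0 \<le> lam v w \<and> lam v w \<le> C" if "v \<in> ?D" for v
      using that lam w C by (auto simp: left_weight_def)
  qed auto
  then show ?thesis by (simp cong: ball_cong)
qed

lemma R_op_ex1:
  assumes rho: "right_weight G rho" and u: "u \<in> dpaths G" and fin: "weight_sup G rho u < \<infinity>"
  shows "\<exists>!T. T \<in> bounded_ops (dpaths G) \<and>
     (\<forall>v\<in>dpaths G. T (ket v) =
        (if source v = range_of u then (\<lambda>x. complex_of_real (rho v u) * ket (v \<cdot> u) x) else (\<lambda>x. 0)))"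
proof -
  obtain C where C: "\<And>v. v \<in> dpaths G \<Longrightarrow> rho v u \<le> C" using weight_sup_bound[OF fin] by blast
  let ?D = "{v \<in> dpaths G. source v = range_of u}"
  have "\<exists>!T. T \<in> bounded_ops (dpaths G) \<and>
     (\<forall>v\<in>dpaths G. T (ket v) =
        (if v \<in> ?D then (\<lambda>x. complex_of_real (rho v u) * ket (v \<cdot> u) x) else (\<lambda>x. 0)))"
  proof (rule weighted_shift_ex1)
    show "(\<lambda>v. v \<cdot> u) ` ?D \<subseteq> dpaths G" using pcomp_in_dpaths_iff[OF u] by blast
    show "inj_on (\<lambda>v. v \<cdot> u) ?D" by (auto intro!: inj_onI dest: pcomp_inj_right)
    show "0 \<le> rho v u \<and> rho v u \<le> C" if "v \<in> ?D" for v
      using that rho u C by (auto simp: right_weight_def)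
  qed auto
  then show ?thesis by (simp cong: ball_cong)
qed

lemmas L_op_spec = theI'[OF L_op_ex1, folded L_op_def]
lemmas R_op_spec = theI'[OF R_op_ex1, folded R_op_def]

end

theory Submission
  imports Defs
begin

text \<open>
  If \<open>T\<close> commutes with all \<open>L\<^sub>w\<close>, then \<open>\<lambda>(x,v) T \<xi>\<^sub>v = L\<^sub>v T \<xi>\<^sub>x\<close> for \<open>x = s(v)\<close>, so \<open>T\<close> is determined
  by the vectors \<open>T \<xi>\<^sub>x\<close>, and the companion identity turns this into the formal series
  \<open>T = \<Sum>\<^sub>u \<alpha>(u) R\<^sub>u\<close>; boundedness of \<open>T\<close> forces \<open>\<rho>(u) < \<infinity>\<close> whenever \<open>\<alpha>(u) \<noteq> 0\<close>. Cutting the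
  series to finitely many \<open>u\<close> of one length, and taking Fejer means over the length, do not
  increase the norm; hence \<open>T\<close> lies in the WOT-closed algebra generated by the \<open>R\<^sub>u\<close>.
  Conversely every \<open>R\<^sub>u\<close> commutes with every \<open>L\<^sub>w\<close>, and commutants are WOT-closed algebras.
\<close>

section \<open>Square-summable families and bounded operators\<close>

text \<open>Matrix entries control the weak operator topology only along norm-bounded nets, so every
  approximation of \<open>T\<close> has to keep a bound independent of the index. Truncating a
  series by length has no such bound in general, hence the Fejer means; and a graph with infinitely
  many arcs can have infinitely many paths of one length, so each homogeneous part is itself a limit
  over finite sets of paths. Both cutoffs multiply matrix entries by a symbol that is an average of
  block indicators, so one counting estimate serves both and no integration over a circle action is
  needed.

  The two sides are not alike: left-boundedness makes every \<open>L_op\<close> a bounded operator,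
  while \<rho>(u) may be infinite for some paths \<open>u\<close>. The argument therefore works with
  the matrix of the formal series, and operators \<open>R_op\<close> appear only where the
  coefficient is nonzero.\<close>

lemma ell2_norm_nonneg [simp]: "ell2_norm f \<ge> 0"
  by (simp add: ell2_norm_def infsum_nonneg)

lemma ell2_norm_power2: "(ell2_norm f)\<^sup>2 = (\<Sum>\<^sub>\<infinity>x. (cmod (f x))\<^sup>2)"
  by (simp add: ell2_norm_def infsum_nonneg)

lemma ell2_norm_ket [simp]: "ell2_norm (ket v) = 1"
proof -
  have "(\<Sum>\<^sub>\<infinity>x. (cmod (ket v x))\<^sup>2) = (\<Sum>\<^sub>\<infinity>x\<in>{v}. (cmod (ket v x))\<^sup>2)"
    by (rule infsum_cong_neutral) (auto simp: ket_def)
  then show ?thesis by (simp add: ell2_norm_def ket_def)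
qed

lemma sum_le_ell2_norm:
  assumes "f \<in> ell2 A" "finite F"
  shows "(\<Sum>x\<in>F. (cmod (f x))\<^sup>2) \<le> (ell2_norm f)\<^sup>2"
  unfolding ell2_norm_power2 using assms by (intro finite_sum_le_infsum) (auto simp: ell2_def)

text \<open>Membership and norm bound come from finite partial sums alone, so later estimates need
  no summability in advance.\<close>

lemma ell2I_finite_sums:
  assumes "\<And>x. x \<notin> A \<Longrightarrow> f x = 0" "K \<ge> 0"
    and "\<And>F. finite F \<Longrightarrow> (\<Sum>x\<in>F. (cmod (f x))\<^sup>2) \<le> K\<^sup>2"
  shows "f \<in> ell2 A" "ell2_norm f \<le> K"
proof -
  have s: "(\<lambda>x. (cmod (f x))\<^sup>2) summable_on UNIV"
    by (rule nonneg_bdd_above_summable_on) (auto intro!: bdd_aboveI[of _ "K\<^sup>2"] assms(3))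
  then show "f \<in> ell2 A" using assms(1) by (simp add: ell2_def)
  have "(\<Sum>\<^sub>\<infinity>x. (cmod (f x))\<^sup>2) \<le> K\<^sup>2"
    by (rule infsum_le_finite_sums[OF s]) (use assms(3) in auto)
  then show "ell2_norm f \<le> K" unfolding ell2_norm_def using assms(2) by (simp add: real_le_lsqrt)
qed

lemma ell2_diff:
  assumes "f \<in> ell2 A" "g \<in> ell2 A"
  shows "(\<lambda>x. f x - g x) \<in> ell2 A"
  using ell2_add[OF assms(1) ell2_scale[OF assms(2), of "-1"]] by simp

text \<open>The coordinate projection onto \<open>P\<close>, defined on all functions: it is also
  applied to constant functions, which need not be square-summable.\<close>

definition cut :: "'p set \<Rightarrow> ('p \<Rightarrow> complex) \<Rightarrow> 'p \<Rightarrow> complex" where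
  "cut P f = (\<lambda>x. if x \<in> P then f x else 0)"

lemma cut_in_ell2:
  assumes "f \<in> ell2 A"
  shows "cut P f \<in> ell2 A" "ell2_norm (cut P f) \<le> ell2_norm f"
proof -
  have *: "(\<Sum>x\<in>F. (cmod (cut P f x))\<^sup>2) \<le> (ell2_norm f)\<^sup>2" if "finite F" for F
  proof -
    have "(\<Sum>x\<in>F. (cmod (cut P f x))\<^sup>2) \<le> (\<Sum>x\<in>F. (cmod (f x))\<^sup>2)"
      by (intro sum_mono) (auto simp: cut_def)
    then show ?thesis using sum_le_ell2_norm[OF assms that] by simp
  qed
  have z: "cut P f x = 0" if "x \<notin> A" for x using assms that by (auto simp: cut_def ell2_def)
  show "cut P f \<in> ell2 A" "ell2_norm (cut P f) \<le> ell2_norm f"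
    using ell2I_finite_sums[of A "cut P f" "ell2_norm f"] z * by auto
qed

lemma ell2_finite_approx:
  assumes f: "f \<in> ell2 A" and e: "e > 0"
  obtains F where "finite F" "F \<subseteq> A" "ell2_norm (\<lambda>x. f x - cut F f x) < e"
proof -
  have sm: "(\<lambda>x. (cmod (f x))\<^sup>2) summable_on UNIV" using f by (simp add: ell2_def)
  have "\<forall>\<^sub>F F in finite_subsets_at_top UNIV.
      dist (\<Sum>x\<in>F. (cmod (f x))\<^sup>2) (\<Sum>\<^sub>\<infinity>x. (cmod (f x))\<^sup>2) < e\<^sup>2"
    using infsum_tendsto[OF sm] e by (intro tendstoD) auto
  then obtain F where F: "finite F" "dist (\<Sum>x\<in>F. (cmod (f x))\<^sup>2) (\<Sum>\<^sub>\<infinity>x. (cmod (f x))\<^sup>2) < e\<^sup>2"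
    by (auto simp: eventually_finite_subsets_at_top)
  have "(\<Sum>\<^sub>\<infinity>x. (cmod (f x - cut (F \<inter> A) f x))\<^sup>2) = (\<Sum>\<^sub>\<infinity>x\<in>UNIV - F. (cmod (f x))\<^sup>2)"
    using f by (intro infsum_cong_neutral) (auto simp: cut_def ell2_def)
  also have "\<dots> = (\<Sum>\<^sub>\<infinity>x. (cmod (f x))\<^sup>2) - (\<Sum>\<^sub>\<infinity>x\<in>F. (cmod (f x))\<^sup>2)"
    using sm F by (intro infsum_Diff) auto
  also have "\<dots> < e\<^sup>2" using F by (simp add: dist_real_def abs_less_iff)
  finally have "ell2_norm (\<lambda>x. f x - cut (F \<inter> A) f x) < e"
    using e unfolding ell2_norm_power2[symmetric] by (simp add: power_less_imp_less_base)
  then show thesis using that[of "F \<inter> A"] F by auto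
qed

section \<open>The inner product and its Cauchy-Schwarz inequality\<close>

lemma ell2_inner_summable:
  assumes f: "f \<in> ell2 A" and g: "g \<in> ell2 A"
  shows "(\<lambda>x. f x * cnj (g x)) summable_on UNIV"
    and "cmod (ell2_inner f g) \<le> ell2_norm f * ell2_norm g"
proof -
  have *: "(\<Sum>x\<in>F. cmod (f x * cnj (g x))) \<le> ell2_norm f * ell2_norm g" if "finite F" for F
  proof -
    have "(\<Sum>x\<in>F. cmod (f x * cnj (g x))) = (\<Sum>x\<in>F. \<bar>cmod (f x)\<bar> * \<bar>cmod (g x)\<bar>)"
      by (simp add: norm_mult)
    also have "\<dots> \<le> L2_set (\<lambda>x. cmod (f x)) F * L2_set (\<lambda>x. cmod (g x)) F"
      by (rule L2_set_mult_ineq)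
    also have "\<dots> \<le> ell2_norm f * ell2_norm g"
      using sum_le_ell2_norm[OF f that] sum_le_ell2_norm[OF g that]
      by (intro mult_mono) (auto simp: L2_set_def real_le_lsqrt sum_nonneg)
    finally show ?thesis .
  qed
  have s: "(\<lambda>x. cmod (f x * cnj (g x))) summable_on UNIV"
  proof (rule nonneg_bdd_above_summable_on)
    show "bdd_above (sum (\<lambda>x. cmod (f x * cnj (g x))) ` {F. F \<subseteq> UNIV \<and> finite F})"
      using * by (intro bdd_aboveI[of _ "ell2_norm f * ell2_norm g"]) blast
  qed simp
  then show "(\<lambda>x. f x * cnj (g x)) summable_on UNIV"
    by (rule Infinite_Sum.abs_summable_summable)
  have "cmod (ell2_inner f g) \<le> (\<Sum>\<^sub>\<infinity>x. cmod (f x * cnj (g x)))"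
    unfolding ell2_inner_def by (rule norm_infsum_bound) (rule s)
  also have "\<dots> \<le> ell2_norm f * ell2_norm g"
    by (rule infsum_le_finite_sums[OF s]) (use * in auto)
  finally show "cmod (ell2_inner f g) \<le> ell2_norm f * ell2_norm g" .
qed

lemma ell2_inner_add_left:
  assumes "f \<in> ell2 A" "g \<in> ell2 A" "h \<in> ell2 A"
  shows "ell2_inner (\<lambda>x. f x + g x) h = ell2_inner f h + ell2_inner g h"
  unfolding ell2_inner_def distrib_right
  by (rule infsum_add) (use ell2_inner_summable(1) assms in blast)+

lemma ell2_inner_scale_left:
  assumes "f \<in> ell2 A" "h \<in> ell2 A"
  shows "ell2_inner (\<lambda>x. c * f x) h = c * ell2_inner f h"
  unfolding ell2_inner_def mult.assoc
  by (rule infsum_cmult_right) (use ell2_inner_summable(1) assms in blast)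

lemma ell2_inner_diff_right:
  assumes "f \<in> ell2 A" "g \<in> ell2 A" "h \<in> ell2 A"
  shows "ell2_inner h (\<lambda>x. f x - g x) = ell2_inner h f - ell2_inner h g"
proof -
  have s: "(\<lambda>x. h x * cnj (f x)) summable_on UNIV" "(\<lambda>x. h x * cnj (g x)) summable_on UNIV"
    using ell2_inner_summable(1) assms by blast+
  have "(\<lambda>x. h x * cnj (f x - g x)) = (\<lambda>x. h x * cnj (f x) + (-1) * (h x * cnj (g x)))"
    by (simp add: algebra_simps)
  then show ?thesis
    using infsum_add[OF s(1) summable_on_cmult_right[OF s(2), of "-1"]]
      infsum_cmult_right[of "-1::complex", OF s(2)]
    by (simp add: ell2_inner_def)
qed

lemma ell2_inner_cut_right:
  assumes "finite F"
  shows "ell2_inner f (cut F g) = (\<Sum>x\<in>F. f x * cnj (g x))"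
proof -
  have "ell2_inner f (cut F g) = (\<Sum>\<^sub>\<infinity>x\<in>F. f x * cnj (g x))"
    unfolding ell2_inner_def by (rule infsum_cong_neutral) (auto simp: cut_def)
  then show ?thesis using assms by simp
qed

lemma ell2_inner_ket_right: "ell2_inner f (ket y) = f y"
proof -
  have "ket y = cut {y} (\<lambda>x. 1)" by (auto simp: ket_def cut_def)
  then show ?thesis by (simp add: ell2_inner_cut_right)
qed

lemma ell2_inner_ket_left: "ell2_inner (ket x) g = cnj (g x)"
proof -
  have "ell2_inner (ket x) g = (\<Sum>\<^sub>\<infinity>z\<in>{x}. ket x z * cnj (g z))"
    unfolding ell2_inner_def by (rule infsum_cong_neutral) (auto simp: ket_def)
  then show ?thesis by (simp add: ket_def)
qed

section \<open>Bounded operators and the rows of their matrices\<close>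

lemma bounded_ops_closed: "T \<in> bounded_ops A \<Longrightarrow> f \<in> ell2 A \<Longrightarrow> T f \<in> ell2 A"
  by (auto simp: bounded_ops_def)

lemma bounded_ops_diff:
  assumes "T \<in> bounded_ops A" "f \<in> ell2 A" "g \<in> ell2 A"
  shows "T (\<lambda>x. f x - g x) = (\<lambda>x. T f x - T g x)"
  using bounded_ops_add[OF assms(1,2) ell2_scale[OF assms(3), of "-1"]]
    bounded_ops_scale[OF assms(1,3), of "-1"] by simp

lemma bounded_ops_bound:
  assumes "T \<in> bounded_ops A"
  obtains C where "C \<ge> 0" "\<And>f. f \<in> ell2 A \<Longrightarrow> ell2_norm (T f) \<le> C * ell2_norm f"
proof -
  obtain C where C: "\<And>f. f \<in> ell2 A \<Longrightarrow> ell2_norm (T f) \<le> C * ell2_norm f"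
    using assms unfolding bounded_ops_def by blast
  have "ell2_norm (T f) \<le> \<bar>C\<bar> * ell2_norm f" if "f \<in> ell2 A" for f
    using C[OF that] mult_right_mono[OF abs_ge_self[of C] ell2_norm_nonneg[of f]] by linarith
  then show thesis using that[of "\<bar>C\<bar>"] by simp
qed

lemma bounded_opsI:
  assumes "\<And>f. f \<in> ell2 A \<Longrightarrow> T f \<in> ell2 A"
    and "\<And>f g. f \<in> ell2 A \<Longrightarrow> g \<in> ell2 A \<Longrightarrow> T (\<lambda>x. f x + g x) = (\<lambda>x. T f x + T g x)"
    and "\<And>c f. f \<in> ell2 A \<Longrightarrow> T (\<lambda>x. c * f x) = (\<lambda>x. c * T f x)"
    and "\<And>f. f \<in> ell2 A \<Longrightarrow> ell2_norm (T f) \<le> C * ell2_norm f"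
  shows "(\<lambda>f\<in>ell2 A. T f) \<in> bounded_ops A"
  unfolding bounded_ops_def
  using assms by (auto simp: ell2_add ell2_scale intro!: exI[of _ C])

lemma bounded_ops_cut_finite:
  assumes T: "T \<in> bounded_ops A" and "finite F" "F \<subseteq> A"
  shows "T (cut F f) = (\<lambda>y. \<Sum>v\<in>F. f v * T (ket v) y)"
  using assms(2,3)
proof (induction F rule: finite_induct)
  case empty
  show ?case using bounded_ops_scale[OF T zero_in_ell2, of 0] by (simp add: cut_def)
next
  case (insert v F)
  have v: "ket v \<in> ell2 A" using insert by (auto intro: ket_in_ell2)
  have F: "cut F f \<in> ell2 A"
  proof -
    have "(\<lambda>x. (cmod (cut F f x))\<^sup>2) summable_on UNIV"
      by (rule finite_nonzero_values_imp_summable_on)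
         (rule finite_subset[OF _ insert(1)], auto simp: cut_def split: if_splits)
    then show ?thesis using insert by (auto simp: ell2_def cut_def)
  qed
  have "cut (insert v F) f = (\<lambda>x. (\<lambda>x. f v * ket v x) x + cut F f x)"
    using insert by (auto simp: cut_def ket_def)
  then have "T (cut (insert v F) f) = (\<lambda>x. T (\<lambda>x. f v * ket v x) x + T (cut F f) x)"
    using bounded_ops_add[OF T ell2_scale[OF v] F] by simp
  also have "T (\<lambda>x. f v * ket v x) = (\<lambda>x. f v * T (ket v) x)"
    by (rule bounded_ops_scale[OF T v])
  finally show ?case using insert by simp
qed

text \<open>Reduces functionals to operators: a bounded functional \<theta> becomes the rank-one
  operator sending \<open>f\<close> to \<theta>(f) times \<open>ket y\<close>, operators are
  determined by their values on kets, and the coordinate at \<open>y\<close> gives \<theta>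
  back.\<close>

lemma ell2_functional_eqI:
  fixes \<phi> \<psi> :: "('p \<Rightarrow> complex) \<Rightarrow> complex"
  assumes "\<And>f g. f \<in> ell2 A \<Longrightarrow> g \<in> ell2 A \<Longrightarrow> \<phi> (\<lambda>x. f x + g x) = \<phi> f + \<phi> g"
    and "\<And>c f. f \<in> ell2 A \<Longrightarrow> \<phi> (\<lambda>x. c * f x) = c * \<phi> f"
    and "\<And>f. f \<in> ell2 A \<Longrightarrow> cmod (\<phi> f) \<le> C * ell2_norm f"
    and "\<And>f g. f \<in> ell2 A \<Longrightarrow> g \<in> ell2 A \<Longrightarrow> \<psi> (\<lambda>x. f x + g x) = \<psi> f + \<psi> g"
    and "\<And>c f. f \<in> ell2 A \<Longrightarrow> \<psi> (\<lambda>x. c * f x) = c * \<psi> f"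
    and "\<And>f. f \<in> ell2 A \<Longrightarrow> cmod (\<psi> f) \<le> D * ell2_norm f"
    and eq: "\<And>v. v \<in> A \<Longrightarrow> \<phi> (ket v) = \<psi> (ket v)"
    and y: "y \<in> A" and f: "f \<in> ell2 A"
  shows "\<phi> f = \<psi> f"
proof -
  have nrm: "ell2_norm (\<lambda>x. c * ket y x) = cmod c" for c
  proof -
    have "(\<Sum>\<^sub>\<infinity>x. (cmod (c * ket y x))\<^sup>2) = (\<Sum>\<^sub>\<infinity>x\<in>{y}. (cmod (c * ket y x))\<^sup>2)"
      by (rule infsum_cong_neutral) (auto simp: ket_def)
    then show ?thesis by (simp add: ell2_norm_def ket_def)
  qed
  have op: "(\<lambda>f\<in>ell2 A. (\<lambda>x. \<theta> f * ket y x)) \<in> bounded_ops A"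
    if "\<And>f g. f \<in> ell2 A \<Longrightarrow> g \<in> ell2 A \<Longrightarrow> \<theta> (\<lambda>x. f x + g x) = \<theta> f + \<theta> g"
      "\<And>c f. f \<in> ell2 A \<Longrightarrow> \<theta> (\<lambda>x. c * f x) = c * \<theta> f"
      "\<And>f. f \<in> ell2 A \<Longrightarrow> cmod (\<theta> f) \<le> B * ell2_norm f" for \<theta> B
    by (rule bounded_opsI[where C=B])
       (auto simp: that nrm distrib_right mult.assoc intro!: ell2_scale ket_in_ell2 y)
  have "(\<lambda>f\<in>ell2 A. (\<lambda>x. \<phi> f * ket y x)) = (\<lambda>f\<in>ell2 A. (\<lambda>x. \<psi> f * ket y x))"
    by (rule bounded_ops_eqI[OF op op]) (use assms ket_in_ell2 in auto)
  from fun_cong[OF this, of f] have "(\<lambda>x. \<phi> f * ket y x) y = (\<lambda>x. \<psi> f * ket y x) y"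
    using f by (metis restrict_apply')
  then show ?thesis by (simp add: ket_def)
qed

text \<open>The Riesz vector of the coordinate functional at \<open>y\<close>, that is, the adjoint
  of \<open>S\<close> applied to \<open>ket y\<close>. It moves \<open>S\<close> to the other side
  of an inner product and extends formulas known on kets to arbitrary vectors.\<close>

lemma bounded_ops_row:
  assumes S: "S \<in> bounded_ops A"
  shows "(\<lambda>x. if x \<in> A then cnj (S (ket x) y) else 0) \<in> ell2 A" (is "?g \<in> _")
    and "f \<in> ell2 A \<Longrightarrow> S f y = ell2_inner f (\<lambda>x. if x \<in> A then cnj (S (ket x) y) else 0)"
proof -
  obtain C where C: "C \<ge> 0" "\<And>f. f \<in> ell2 A \<Longrightarrow> ell2_norm (S f) \<le> C * ell2_norm f"
    using bounded_ops_bound[OF S] by blast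
  have Cy: "cmod (S f y) \<le> C * ell2_norm f" if "f \<in> ell2 A" for f
    using cmod_le_ell2_norm[OF bounded_ops_closed[OF S that]] C(2)[OF that] by (rule order_trans)
  have sums: "(\<Sum>x\<in>F. (cmod (?g x))\<^sup>2) \<le> C\<^sup>2" if fin: "finite F" for F
  proof -
    \<comment> \<open>\<open>S\<close> is tested on a finite section of its own conjugated row: the
      value at \<open>y\<close> is the sum of squares \<open>?s\<close> and the norm of the section
      is \<open>sqrt ?s\<close>, so \<open>?s\<close> is at most \<open>C * sqrt ?s\<close>.\<close>
    let ?F = "F \<inter> A" and ?s = "\<Sum>x\<in>F \<inter> A. (cmod (?g x))\<^sup>2"
    have h: "cut ?F ?g \<in> ell2 A"
    proof -
      have "(\<lambda>x. (cmod (cut ?F ?g x))\<^sup>2) summable_on UNIV"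
        by (rule finite_nonzero_values_imp_summable_on)
           (rule finite_subset[OF _ fin], auto simp: cut_def split: if_splits)
      then show ?thesis by (auto simp: ell2_def cut_def)
    qed
    have "(\<Sum>\<^sub>\<infinity>x. (cmod (cut ?F ?g x))\<^sup>2) = (\<Sum>\<^sub>\<infinity>x\<in>?F. (cmod (?g x))\<^sup>2)"
      by (rule infsum_cong_neutral) (auto simp: cut_def)
    then have nh: "ell2_norm (cut ?F ?g) = sqrt ?s" using fin by (simp add: ell2_norm_def)
    have "S (cut ?F ?g) y = (\<Sum>x\<in>?F. ?g x * S (ket x) y)"
      using bounded_ops_cut_finite[OF S, of ?F ?g] fin by simp
    also have "\<dots> = (\<Sum>x\<in>?F. of_real ((cmod (?g x))\<^sup>2))"
      by (intro sum.cong) (auto simp: complex_norm_square mult.commute simp del: of_real_power)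
    finally have "S (cut ?F ?g) y = of_real ?s" by simp
    then have "cmod (of_real ?s) \<le> C * sqrt ?s" using Cy[OF h] nh by metis
    moreover have s0: "?s \<ge> 0" by (rule sum_nonneg) simp
    ultimately have "sqrt ?s * sqrt ?s \<le> C * sqrt ?s"
      by (simp only: norm_of_real abs_of_nonneg real_sqrt_mult_self)
    then have "sqrt ?s \<le> C"
    proof (cases "sqrt ?s > 0")
      case False
      then have "sqrt ?s = 0" using real_sqrt_ge_zero[OF s0] by linarith
      then show ?thesis using C(1) by linarith
    qed (rule mult_right_le_imp_le)
    then have "?s \<le> C\<^sup>2" by (rule sqrt_le_D)
    moreover have "(\<Sum>x\<in>F. (cmod (?g x))\<^sup>2) = ?s"
      using fin by (intro sum.mono_neutral_right) auto
    ultimately show ?thesis by simp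
  qed
  show g: "?g \<in> ell2 A" by (rule ell2I_finite_sums[OF _ C(1) sums]) auto
  show "S f y = ell2_inner f ?g" if f: "f \<in> ell2 A"
  proof (cases "y \<in> A")
    case True
    show ?thesis
    proof (rule ell2_functional_eqI[where \<phi>="\<lambda>f. S f y" and \<psi>="\<lambda>f. ell2_inner f ?g", OF _ _ _ _ _ _ _ True f])
      show "cmod (S f y) \<le> C * ell2_norm f" if "f \<in> ell2 A" for f by (rule Cy[OF that])
      show "cmod (ell2_inner f ?g) \<le> ell2_norm ?g * ell2_norm f" if "f \<in> ell2 A" for f
        using ell2_inner_summable(2)[OF that g] by (simp add: mult.commute)
      show "S (ket v) y = ell2_inner (ket v) ?g" if "v \<in> A" for v
        using that by (simp add: ell2_inner_ket_left)
    qed (use bounded_ops_add[OF S] bounded_ops_scale[OF S] ell2_inner_add_left[OF _ _ g]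
          ell2_inner_scale_left[OF _ g] in auto)
  next
    case False
    then have "S h y = 0" if "h \<in> ell2 A" for h
      using bounded_ops_closed[OF S that] by (auto simp: ell2_def)
    moreover from this have "?g = (\<lambda>x. 0)" using ket_in_ell2[of _ A] by fastforce
    ultimately show ?thesis using f by (simp add: ell2_inner_def)
  qed
qed

section \<open>Schur multipliers and the weak operator topology\<close>

lemma sum_squared_le_card:
  fixes a :: "'i \<Rightarrow> complex"
  shows "(cmod (\<Sum>i\<in>I. a i))\<^sup>2 \<le> of_nat (card I) * (\<Sum>i\<in>I. (cmod (a i))\<^sup>2)"
proof -
  have "(cmod (\<Sum>i\<in>I. a i))\<^sup>2 \<le> (\<Sum>i\<in>I. cmod (a i) * 1)\<^sup>2"
    by (intro power_mono) (auto intro: norm_sum)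
  also have "\<dots> \<le> (\<Sum>i\<in>I. (cmod (a i))\<^sup>2) * (\<Sum>i\<in>I. 1\<^sup>2)"
    by (rule Cauchy_Schwarz_ineq_sum)
  finally show ?thesis by (simp add: mult.commute)
qed

lemma infsum_finite_sum:
  fixes f :: "'i \<Rightarrow> 'p \<Rightarrow> real"
  assumes "finite I" "\<And>i. i \<in> I \<Longrightarrow> f i summable_on UNIV"
  shows "(\<lambda>x. \<Sum>i\<in>I. f i x) summable_on UNIV"
    and "(\<Sum>\<^sub>\<infinity>x. \<Sum>i\<in>I. f i x) = (\<Sum>i\<in>I. \<Sum>\<^sub>\<infinity>x. f i x)"
proof -
  have "(\<lambda>x. \<Sum>i\<in>I. f i x) summable_on UNIV \<and> (\<Sum>\<^sub>\<infinity>x. \<Sum>i\<in>I. f i x) = (\<Sum>i\<in>I. \<Sum>\<^sub>\<infinity>x. f i x)"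
    using assms by (induction I rule: finite_induct) (auto simp: infsum_add intro!: summable_on_add)
  then show "(\<lambda>x. \<Sum>i\<in>I. f i x) summable_on UNIV"
    "(\<Sum>\<^sub>\<infinity>x. \<Sum>i\<in>I. f i x) = (\<Sum>i\<in>I. \<Sum>\<^sub>\<infinity>x. f i x)" by auto
qed

text \<open>
  The multiplier with symbol \<open>1/n \<cdot> #{m. v \<in> P m \<and> y \<in> B m}\<close> compresses \<open>T\<close> to the blocks
  \<open>B m \<times> P m\<close> and averages; since every point lies in at most \<open>n\<close> blocks this does not
  increase the norm. Fejer's kernel is of this form.
\<close>

lemma schur_multiplier:
  fixes P B :: "nat \<Rightarrow> 'p set"
  assumes T: "T \<in> bounded_ops A" and n: "n > 0"
    and C: "C \<ge> 0" "\<And>f. f \<in> ell2 A \<Longrightarrow> ell2_norm (T f) \<le> C * ell2_norm f"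
    and P: "\<And>x. finite {m. x \<in> P m}" "\<And>x. card {m. x \<in> P m} \<le> n"
    and B: "\<And>y. finite {m. y \<in> B m}" "\<And>y. card {m. y \<in> B m} \<le> n"
  obtains S where "S \<in> bounded_ops A" "\<And>f. f \<in> ell2 A \<Longrightarrow> ell2_norm (S f) \<le> C * ell2_norm f"
    "\<And>v y. v \<in> A \<Longrightarrow> S (ket v) y = of_real (card {m. v \<in> P m \<and> y \<in> B m} / n) * T (ket v) y"
proof -
  \<comment> \<open>Pointwise form of the average of all compressions \<open>cut (B m)\<close> after
    \<open>T\<close> after \<open>cut (P m)\<close>. Infinitely many \<open>m\<close> may occur
    altogether, but at each \<open>y\<close> only finitely many contribute.\<close>
  define S0 where "S0 f y = (\<Sum>m\<in>{m. y \<in> B m}. T (cut (P m) f) y) / of_nat n" for f y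
  note cutP = cut_in_ell2(1)[of _ A "P _"]
  have bound: "S0 f \<in> ell2 A" "ell2_norm (S0 f) \<le> C * ell2_norm f" if f: "f \<in> ell2 A" for f
  proof -
    have z: "S0 f x = 0" if "x \<notin> A" for x
      using bounded_ops_closed[OF T cutP[OF f]] that by (simp add: S0_def ell2_def)
    have sm: "(\<lambda>x. (cmod (f x))\<^sup>2) summable_on UNIV" using f by (simp add: ell2_def)
    have *: "(\<Sum>y\<in>Y. (cmod (S0 f y))\<^sup>2) \<le> (C * ell2_norm f)\<^sup>2" if Y: "finite Y" for Y
    proof -
      define J where "J = (\<Union>y\<in>Y. {m. y \<in> B m})"
      have J: "finite J" using Y B(1) by (simp add: J_def)
      let ?t = "\<lambda>m y. (cmod (T (cut (P m) f) y))\<^sup>2"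
      \<comment> \<open>Cauchy-Schwarz over at most \<open>n\<close> terms costs a factor
        \<open>n\<close> against the \<open>n\<close> squared of the average, which leaves a factor
        \<open>1/n\<close>.\<close>
      have "(cmod (S0 f y))\<^sup>2 \<le> (\<Sum>m\<in>J. ?t m y) / n" if y: "y \<in> Y" for y
      proof -
        have "(cmod (S0 f y))\<^sup>2 = (cmod (\<Sum>m\<in>{m. y \<in> B m}. T (cut (P m) f) y))\<^sup>2 / (real n)\<^sup>2"
          by (simp add: S0_def norm_divide power_divide)
        also have "\<dots> \<le> (of_nat (card {m. y \<in> B m}) * (\<Sum>m\<in>{m. y \<in> B m}. ?t m y)) / (real n)\<^sup>2"
          by (intro divide_right_mono sum_squared_le_card) auto
        also have "\<dots> \<le> (n * (\<Sum>m\<in>J. ?t m y)) / (real n)\<^sup>2"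
          using y J B(2) by (intro divide_right_mono mult_mono sum_mono2) (auto simp: J_def intro: sum_nonneg)
        also have "\<dots> = (\<Sum>m\<in>J. ?t m y) / n" using n by (simp add: power2_eq_square)
        finally show ?thesis .
      qed
      then have "(\<Sum>y\<in>Y. (cmod (S0 f y))\<^sup>2) \<le> (\<Sum>y\<in>Y. (\<Sum>m\<in>J. ?t m y) / n)"
        by (rule sum_mono)
      also have "\<dots> = (\<Sum>m\<in>J. \<Sum>y\<in>Y. ?t m y) / n"
        unfolding sum_divide_distrib[symmetric] by (subst sum.swap) simp
      also have "\<dots> \<le> (\<Sum>m\<in>J. C\<^sup>2 * (ell2_norm (cut (P m) f))\<^sup>2) / n"
      proof (intro divide_right_mono sum_mono)
        fix m
        have "(\<Sum>y\<in>Y. ?t m y) \<le> (ell2_norm (T (cut (P m) f)))\<^sup>2"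
          by (rule sum_le_ell2_norm[OF bounded_ops_closed[OF T cutP[OF f]] Y])
        also have "\<dots> \<le> (C * ell2_norm (cut (P m) f))\<^sup>2"
          using C(2)[OF cutP[OF f]] by (intro power_mono) auto
        finally show "(\<Sum>y\<in>Y. ?t m y) \<le> C\<^sup>2 * (ell2_norm (cut (P m) f))\<^sup>2"
          by (simp add: power_mult_distrib)
      qed simp
      also have "\<dots> = C\<^sup>2 * ((\<Sum>m\<in>J. (ell2_norm (cut (P m) f))\<^sup>2) / n)"
        by (simp add: sum_distrib_left)
      also have "(\<Sum>m\<in>J. (ell2_norm (cut (P m) f))\<^sup>2) = (\<Sum>\<^sub>\<infinity>x. \<Sum>m\<in>J. (cmod (cut (P m) f x))\<^sup>2)"
        unfolding ell2_norm_power2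
        using cutP[OF f] J by (intro infsum_finite_sum(2)[symmetric]) (auto simp: ell2_def)
      \<comment> \<open>The remaining \<open>1/n\<close> is paid for here: each \<open>x\<close>
        lies in at most \<open>n\<close> of the sets \<open>P m\<close>, so the cut vectors together
        carry at most \<open>n\<close> times the squared norm of \<open>f\<close>.\<close>
      also have "\<dots> \<le> (\<Sum>\<^sub>\<infinity>x. n * (cmod (f x))\<^sup>2)"
      proof (rule infsum_mono)
        show "(\<lambda>x. \<Sum>m\<in>J. (cmod (cut (P m) f x))\<^sup>2) summable_on UNIV"
          using cutP[OF f] J by (intro infsum_finite_sum(1)) (auto simp: ell2_def)
        show "(\<lambda>x. n * (cmod (f x))\<^sup>2) summable_on UNIV"
          by (rule summable_on_cmult_right[OF sm])
        fix x
        have "(\<Sum>m\<in>J. (cmod (cut (P m) f x))\<^sup>2) = (\<Sum>m\<in>J \<inter> {m. x \<in> P m}. (cmod (f x))\<^sup>2)"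
          using J by (intro sum.mono_neutral_cong_right) (auto simp: cut_def)
        also have "\<dots> = card (J \<inter> {m. x \<in> P m}) * (cmod (f x))\<^sup>2" by simp
        also have "\<dots> \<le> n * (cmod (f x))\<^sup>2"
          using card_mono[OF P(1)[of x], of "J \<inter> {m. x \<in> P m}"] P(2)[of x]
          by (intro mult_right_mono) auto
        finally show "(\<Sum>m\<in>J. (cmod (cut (P m) f x))\<^sup>2) \<le> n * (cmod (f x))\<^sup>2" .
      qed
      also have "\<dots> = n * (ell2_norm f)\<^sup>2"
        unfolding ell2_norm_power2 by (rule infsum_cmult_right) (use sm in auto)
      finally show ?thesis
        using n by (simp add: power_mult_distrib divide_right_mono mult_left_mono)
    qed
    show "S0 f \<in> ell2 A" "ell2_norm (S0 f) \<le> C * ell2_norm f"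
      using ell2I_finite_sums[of A "S0 f" "C * ell2_norm f"] z * C(1) by auto
  qed
  have lin: "S0 (\<lambda>x. f x + g x) = (\<lambda>x. S0 f x + S0 g x)" if "f \<in> ell2 A" "g \<in> ell2 A" for f g
  proof -
    have "cut (P m) (\<lambda>x. f x + g x) = (\<lambda>x. cut (P m) f x + cut (P m) g x)" for m
      by (auto simp: cut_def)
    then show ?thesis
      using bounded_ops_add[OF T cutP cutP] that
      by (auto simp: S0_def sum.distrib add_divide_distrib)
  qed
  have scl: "S0 (\<lambda>x. c * f x) = (\<lambda>x. c * S0 f x)" if "f \<in> ell2 A" for c f
  proof -
    have "cut (P m) (\<lambda>x. c * f x) = (\<lambda>x. c * cut (P m) f x)" for m
      by (auto simp: cut_def)
    then show ?thesis
      using bounded_ops_scale[OF T cutP] that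
      by (auto simp: S0_def sum_distrib_left)
  qed
  have T0: "T (\<lambda>x. 0) = (\<lambda>x. 0)"
    using bounded_ops_scale[OF T zero_in_ell2, of 0] by simp
  have ket: "S0 (ket v) y = of_real (card {m. v \<in> P m \<and> y \<in> B m} / n) * T (ket v) y" for v y
  proof -
    have c: "cut (P m) (ket v) = (if v \<in> P m then ket v else (\<lambda>x. 0))" for m
      by (auto simp: cut_def ket_def)
    have "(\<Sum>m\<in>{m. y \<in> B m}. T (cut (P m) (ket v)) y) = (\<Sum>m\<in>{m. v \<in> P m \<and> y \<in> B m}. T (ket v) y)"
      using B(1) by (intro sum.mono_neutral_cong_right) (auto simp: c T0)
    then show ?thesis by (simp add: S0_def)
  qed
  show thesis
  proof (rule that)
    show "(\<lambda>f\<in>ell2 A. S0 f) \<in> bounded_ops A"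
      by (rule bounded_opsI[where C=C]) (auto simp: bound lin scl)
  qed (auto simp: bound ket ket_in_ell2)
qed

section \<open>Weak operator limits of norm-bounded nets\<close>

text \<open>The three-epsilon argument: the error is uniform in \<open>i\<close>, so the limit of
  the approximants carries over. The filter is arbitrary, to serve nets over finite sets as well as
  sequences.\<close>

lemma tendsto_approx:
  fixes a :: "'i \<Rightarrow> complex"
  assumes "\<And>e. e > 0 \<Longrightarrow> \<exists>a' l'. (a' \<longlongrightarrow> l') F \<and> (\<forall>i. cmod (a i - a' i) \<le> e) \<and> cmod (l - l') \<le> e"
  shows "(a \<longlongrightarrow> l) F"
proof (rule tendstoI)
  fix e :: real assume e: "e > 0"
  obtain a' l' where a': "(a' \<longlongrightarrow> l') F" "\<And>i. cmod (a i - a' i) \<le> e / 4" "cmod (l - l') \<le> e / 4"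
    using assms[of "e / 4"] e by auto
  have "\<forall>\<^sub>F i in F. dist (a' i) l' < e / 4" using a'(1) e by (intro tendstoD) auto
  then show "\<forall>\<^sub>F i in F. dist (a i) l < e"
  proof eventually_elim
    case (elim i)
    have "a i - l = (a i - a' i) + (a' i - l') + (l' - l)" by simp
    then have "cmod (a i - l) \<le> cmod (a i - a' i) + cmod (a' i - l') + cmod (l' - l)"
      by (metis norm_triangle_mono norm_triangle_ineq order_refl)
    then show ?case using elim a'(2)[of i] a'(3) e
      by (simp add: dist_norm norm_minus_commute)
  qed
qed

text \<open>Finitely supported vectors are dense, and the common bound \<open>C\<close> makes
  replacing a vector by a finite section harmless uniformly in \<open>i\<close>. This is done twice:
  for \<open>f\<close>, which yields convergence of each coordinate, then for
  \<open>g\<close>.\<close>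

lemma bounded_net_inner_tendsto:
  assumes S: "\<And>i. S i \<in> bounded_ops A" and T: "T \<in> bounded_ops A" and C: "C \<ge> 0"
    and SC: "\<And>i f. f \<in> ell2 A \<Longrightarrow> ell2_norm (S i f) \<le> C * ell2_norm f"
    and TC: "\<And>f. f \<in> ell2 A \<Longrightarrow> ell2_norm (T f) \<le> C * ell2_norm f"
    and lim: "\<And>v y. v \<in> A \<Longrightarrow> ((\<lambda>i. S i (ket v) y) \<longlongrightarrow> T (ket v) y) F"
    and f: "f \<in> ell2 A" and g: "g \<in> ell2 A"
  shows "((\<lambda>i. ell2_inner (S i f) g) \<longlongrightarrow> ell2_inner (T f) g) F"
proof -
  have pt: "((\<lambda>i. S i f y) \<longlongrightarrow> T f y) F" for y
  proof (rule tendsto_approx)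
    fix e :: real assume e: "e > 0"
    \<comment> \<open>\<open>C + 1\<close> instead of \<open>C\<close> keeps the quotient meaningful
      when \<open>C\<close> is zero.\<close>
    obtain Q where Q: "finite Q" "Q \<subseteq> A" "ell2_norm (\<lambda>x. f x - cut Q f x) < e / (C + 1)"
      using ell2_finite_approx[OF f, of "e / (C + 1)"] e C by auto
    note cf = cut_in_ell2(1)[OF f, of Q] and d = ell2_diff[OF f cut_in_ell2(1)[OF f, of Q]]
    have Ce: "C * ell2_norm (\<lambda>x. f x - cut Q f x) \<le> e"
    proof -
      have "C * ell2_norm (\<lambda>x. f x - cut Q f x) \<le> (C + 1) * (e / (C + 1))"
        using Q(3) C e by (intro mult_mono) auto
      then show ?thesis using C by simp
    qed
    have near: "cmod (R f y - R (cut Q f) y) \<le> e"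
      if R: "R \<in> bounded_ops A" "\<And>f. f \<in> ell2 A \<Longrightarrow> ell2_norm (R f) \<le> C * ell2_norm f" for R
    proof -
      have "R f y - R (cut Q f) y = R (\<lambda>x. f x - cut Q f x) y"
        using bounded_ops_diff[OF R(1) f cf] by simp
      then show ?thesis
        using cmod_le_ell2_norm[OF bounded_ops_closed[OF R(1) d], of y] R(2)[OF d] Ce by simp
    qed
    have "((\<lambda>i. S i (cut Q f) y) \<longlongrightarrow> T (cut Q f) y) F"
      unfolding bounded_ops_cut_finite[OF S Q(1,2)] bounded_ops_cut_finite[OF T Q(1,2)]
      using Q by (intro tendsto_intros lim) auto
    then show "\<exists>a' l'. (a' \<longlongrightarrow> l') F \<and> (\<forall>i. cmod (S i f y - a' i) \<le> e) \<and> cmod (T f y - l') \<le> e"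
      using near[OF S SC] near[OF T TC] by blast
  qed
  show ?thesis
  proof (rule tendsto_approx)
    fix e :: real assume e: "e > 0"
    define K where "K = C * ell2_norm f"
    have K: "K \<ge> 0" using C by (simp add: K_def)
    obtain Q where Q: "finite Q" "Q \<subseteq> A" "ell2_norm (\<lambda>x. g x - cut Q g x) < e / (K + 1)"
      using ell2_finite_approx[OF g, of "e / (K + 1)"] e K by auto
    note cg = cut_in_ell2(1)[OF g, of Q] and d = ell2_diff[OF g cut_in_ell2(1)[OF g, of Q]]
    have near: "cmod (ell2_inner h g - ell2_inner h (cut Q g)) \<le> e"
      if h: "h \<in> ell2 A" "ell2_norm h \<le> K" for h
    proof -
      have "cmod (ell2_inner h g - ell2_inner h (cut Q g)) = cmod (ell2_inner h (\<lambda>x. g x - cut Q g x))"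
        using ell2_inner_diff_right[OF g cg h(1)] by simp
      also have "\<dots> \<le> ell2_norm h * ell2_norm (\<lambda>x. g x - cut Q g x)"
        by (rule ell2_inner_summable(2)[OF h(1) d])
      also have "\<dots> \<le> (K + 1) * (e / (K + 1))"
        using Q(3) K h e by (intro mult_mono) auto
      finally show ?thesis using K by simp
    qed
    have "((\<lambda>i. ell2_inner (S i f) (cut Q g)) \<longlongrightarrow> ell2_inner (T f) (cut Q g)) F"
      unfolding ell2_inner_cut_right[OF Q(1)] by (intro tendsto_intros pt)
    then show "\<exists>a' l'. (a' \<longlongrightarrow> l') F \<and> (\<forall>i. cmod (ell2_inner (S i f) g - a' i) \<le> e)
        \<and> cmod (ell2_inner (T f) g - l') \<le> e"
      using near bounded_ops_closed[OF S f] bounded_ops_closed[OF T f] SC[OF f] TC[OF f]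
      unfolding K_def by blast
  qed
qed

lemma wot_closed_bounded_limit:
  assumes M: "closedin (wot A) M" and F: "F \<noteq> bot"
    and SM: "\<And>i. S i \<in> M" and T: "T \<in> bounded_ops A" and C: "C \<ge> 0"
    and SC: "\<And>i f. f \<in> ell2 A \<Longrightarrow> ell2_norm (S i f) \<le> C * ell2_norm f"
    and TC: "\<And>f. f \<in> ell2 A \<Longrightarrow> ell2_norm (T f) \<le> C * ell2_norm f"
    and lim: "\<And>v y. v \<in> A \<Longrightarrow> ((\<lambda>i. S i (ket v) y) \<longlongrightarrow> T (ket v) y) F"
  shows "T \<in> M"
proof -
  have S: "S i \<in> bounded_ops A" for i
    using SM closedin_subset[OF M] by (auto simp: topspace_wot)
  have "limitin (wot A) S T F"
    unfolding limitin_def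
  proof (intro conjI allI impI)
    show "T \<in> topspace (wot A)" using T by (simp add: topspace_wot)
    fix W assume "openin (wot A) W \<and> T \<in> W"
    then have "generate_topology_on
        {{T \<in> bounded_ops A. ell2_inner (T f) g \<in> U} | f g U. f \<in> ell2 A \<and> g \<in> ell2 A \<and> open U} W"
      and "T \<in> W"
      by (simp_all add: wot_def openin_topology_generated_by_iff)
    \<comment> \<open>The topology is given by a subbasis only, so eventual membership is carried
      through intersections and unions; the analysis sits in the subbasic case.\<close>
    then show "\<forall>\<^sub>F i in F. S i \<in> W"
    proof (induction W rule: generate_topology_on.induct)
      case (Int a b)
      then show ?case by (auto elim: eventually_elim2)
    next
      case (UN K)
      then obtain k where "k \<in> K" "T \<in> k" by blast
      then show ?case using UN(2)[of k] by (auto elim: eventually_mono)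
    next
      case (Basis s)
      then obtain f g U where s: "s = {T \<in> bounded_ops A. ell2_inner (T f) g \<in> U}"
        and fg: "f \<in> ell2 A" "g \<in> ell2 A" "open U" by blast
      have "((\<lambda>i. ell2_inner (S i f) g) \<longlongrightarrow> ell2_inner (T f) g) F"
        by (rule bounded_net_inner_tendsto[OF S T C SC TC lim fg(1,2)])
      then have "\<forall>\<^sub>F i in F. ell2_inner (S i f) g \<in> U"
        using fg(3) Basis by (auto simp: s dest: topological_tendstoD)
      then show ?case by eventually_elim (simp add: s S)
    qed simp
  qed
  then show ?thesis by (rule limitin_closedin[OF _ M _ F]) (simp add: SM)
qed

lemma continuous_map_wot_inner:
  assumes "f \<in> ell2 A" "g \<in> ell2 A"
  shows "continuous_map (wot A) euclidean (\<lambda>T. ell2_inner (T f) g)"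
  unfolding continuous_map_def topspace_wot
proof (intro conjI allI impI)
  fix U :: "complex set" assume "openin euclidean U"
  then show "openin (wot A) {T \<in> bounded_ops A. ell2_inner (T f) g \<in> U}"
    unfolding wot_def using assms by (intro topology_generated_by_Basis) auto
qed simp

section \<open>The algebra of bounded operators\<close>

lemma id_in_bounded_ops: "(\<lambda>f\<in>ell2 A. f) \<in> bounded_ops A"
  by (rule bounded_opsI[where C=1]) auto

lemma ell2_norm_triangle:
  assumes f: "f \<in> ell2 A" and g: "g \<in> ell2 A"
  shows "ell2_norm (\<lambda>x. f x + g x) \<le> ell2_norm f + ell2_norm g"
proof (rule ell2I_finite_sums(2)[of A])
  fix F :: "'a set" assume F: "finite F"
  have "L2_set (\<lambda>x. cmod (f x + g x)) F \<le> L2_set (\<lambda>x. cmod (f x) + cmod (g x)) F"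
    by (intro L2_set_mono norm_triangle_ineq) auto
  also have "\<dots> \<le> L2_set (\<lambda>x. cmod (f x)) F + L2_set (\<lambda>x. cmod (g x)) F"
    by (rule L2_set_triangle_ineq)
  also have "\<dots> \<le> ell2_norm f + ell2_norm g"
    using sum_le_ell2_norm[OF f F] sum_le_ell2_norm[OF g F]
    by (intro add_mono) (auto simp: L2_set_def real_le_lsqrt sum_nonneg)
  finally have "L2_set (\<lambda>x. cmod (f x + g x)) F \<le> ell2_norm f + ell2_norm g" .
  then have "(L2_set (\<lambda>x. cmod (f x + g x)) F)\<^sup>2 \<le> (ell2_norm f + ell2_norm g)\<^sup>2"
    by (intro power_mono) auto
  then show "(\<Sum>x\<in>F. (cmod (f x + g x))\<^sup>2) \<le> (ell2_norm f + ell2_norm g)\<^sup>2"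
    by (simp add: L2_set_def sum_nonneg)
qed (use f g in \<open>auto simp: ell2_def\<close>)

lemma ell2_norm_scale:
  assumes "f \<in> ell2 A"
  shows "ell2_norm (\<lambda>x. c * f x) = cmod c * ell2_norm f"
proof -
  have "(\<Sum>\<^sub>\<infinity>x. (cmod (c * f x))\<^sup>2) = (cmod c)\<^sup>2 * (\<Sum>\<^sub>\<infinity>x. (cmod (f x))\<^sup>2)"
    unfolding norm_mult power_mult_distrib
    by (rule infsum_cmult_right) (use assms in \<open>auto simp: ell2_def\<close>)
  then show ?thesis by (simp add: ell2_norm_def real_sqrt_mult)
qed

lemma add_in_bounded_ops:
  assumes S: "S \<in> bounded_ops A" and T: "T \<in> bounded_ops A"
  shows "(\<lambda>f\<in>ell2 A. \<lambda>x. S f x + T f x) \<in> bounded_ops A"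
proof -
  obtain C D where "\<And>f. f \<in> ell2 A \<Longrightarrow> ell2_norm (S f) \<le> C * ell2_norm f"
    "\<And>f. f \<in> ell2 A \<Longrightarrow> ell2_norm (T f) \<le> D * ell2_norm f"
    using bounded_ops_bound[OF S] bounded_ops_bound[OF T] by metis
  then have "ell2_norm (\<lambda>x. S f x + T f x) \<le> (C + D) * ell2_norm f" if "f \<in> ell2 A" for f
    using ell2_norm_triangle[OF bounded_ops_closed[OF S that] bounded_ops_closed[OF T that]] that
    unfolding distrib_right by (meson add_mono order_trans)
  then show ?thesis
    by (intro bounded_opsI[where C="C + D"])
       (auto simp: bounded_ops_closed[OF S] bounded_ops_closed[OF T] bounded_ops_add[OF S]
        bounded_ops_add[OF T] bounded_ops_scale[OF S] bounded_ops_scale[OF T] algebra_simps intro!: ell2_add)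
qed

lemma scale_in_bounded_ops:
  assumes T: "T \<in> bounded_ops A"
  shows "(\<lambda>f\<in>ell2 A. \<lambda>x. c * T f x) \<in> bounded_ops A"
proof -
  obtain D where D: "\<And>f. f \<in> ell2 A \<Longrightarrow> ell2_norm (T f) \<le> D * ell2_norm f"
    using bounded_ops_bound[OF T] by metis
  have "ell2_norm (\<lambda>x. c * T f x) \<le> (cmod c * D) * ell2_norm f" if "f \<in> ell2 A" for f
    using ell2_norm_scale[OF bounded_ops_closed[OF T that], of c] mult_left_mono[OF D[OF that], of "cmod c"]
    by (simp add: mult.assoc)
  then show ?thesis
    by (intro bounded_opsI[where C="cmod c * D"])
       (auto simp: bounded_ops_closed[OF T] bounded_ops_add[OF T] bounded_ops_scale[OF T] algebra_simps
         intro!: ell2_scale)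
qed

lemma compose_in_bounded_ops:
  assumes S: "S \<in> bounded_ops A" and T: "T \<in> bounded_ops A"
  shows "compose (ell2 A) S T \<in> bounded_ops A"
proof -
  obtain C D where C: "C \<ge> 0" "\<And>f. f \<in> ell2 A \<Longrightarrow> ell2_norm (S f) \<le> C * ell2_norm f"
    and D: "\<And>f. f \<in> ell2 A \<Longrightarrow> ell2_norm (T f) \<le> D * ell2_norm f"
    using bounded_ops_bound[OF S] bounded_ops_bound[OF T] by metis
  have "ell2_norm (S (T f)) \<le> (C * D) * ell2_norm f" if "f \<in> ell2 A" for f
    using C(2)[OF bounded_ops_closed[OF T that]] mult_left_mono[OF D[OF that] C(1)]
    by (simp add: mult.assoc)
  then show ?thesis unfolding compose_def
    by (intro bounded_opsI[where C="C * D"])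
       (auto simp: bounded_ops_closed[OF S] bounded_ops_closed[OF T] bounded_ops_add[OF S]
        bounded_ops_add[OF T] bounded_ops_scale[OF S] bounded_ops_scale[OF T])
qed

lemma unital_subalgebra_sum:
  assumes M: "unital_subalgebra A M" and "finite I" "\<And>i. i \<in> I \<Longrightarrow> S i \<in> M"
  shows "(\<lambda>f\<in>ell2 A. \<lambda>x. \<Sum>i\<in>I. c i * S i f x) \<in> M"
  using assms(2,3)
proof (induction I rule: finite_induct)
  case empty
  have "(\<lambda>f\<in>ell2 A. \<lambda>x. 0 * (\<lambda>f\<in>ell2 A. f) f x) \<in> M"
    using M unfolding unital_subalgebra_def by blast
  also have "(\<lambda>f\<in>ell2 A. \<lambda>x. 0 * (\<lambda>f\<in>ell2 A. f) f x) = (\<lambda>f\<in>ell2 A. \<lambda>x. \<Sum>i\<in>{}. c i * S i f x)"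
    by simp
  finally show ?case .
next
  case (insert i I)
  have "(\<lambda>f\<in>ell2 A. \<lambda>x. c i * S i f x) \<in> M"
    using M insert.prems[of i] unfolding unital_subalgebra_def by blast
  moreover have "(\<lambda>f\<in>ell2 A. \<lambda>x. \<Sum>i\<in>I. c i * S i f x) \<in> M"
    by (rule insert.IH) (rule insert.prems, simp)
  ultimately have "(\<lambda>f\<in>ell2 A. \<lambda>x. (\<lambda>f\<in>ell2 A. \<lambda>x. c i * S i f x) f x
      + (\<lambda>f\<in>ell2 A. \<lambda>x. \<Sum>i\<in>I. c i * S i f x) f x) \<in> M" (is "?L \<in> M")
    using M unfolding unital_subalgebra_def by blast
  also have "?L = (\<lambda>f\<in>ell2 A. \<lambda>x. \<Sum>i\<in>insert i I. c i * S i f x)"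
    using insert by (auto simp: restrict_def)
  finally show ?case .
qed

section \<open>Commutants as WOT-closed unital algebras\<close>

lemma commutantI:
  assumes "T \<in> bounded_ops A" "\<And>S f. S \<in> X \<Longrightarrow> f \<in> ell2 A \<Longrightarrow> T (S f) = S (T f)"
  shows "T \<in> commutant A X"
  using assms by (auto simp: commutant_def compose_def restrict_def)

lemma commutantD:
  assumes "T \<in> commutant A X"
  shows "T \<in> bounded_ops A" "S \<in> X \<Longrightarrow> f \<in> ell2 A \<Longrightarrow> T (S f) = S (T f)"
proof -
  show "T \<in> bounded_ops A" using assms by (simp add: commutant_def)
  assume "S \<in> X" "f \<in> ell2 A"
  then have "compose (ell2 A) T S f = compose (ell2 A) S T f" using assms by (simp add: commutant_def)
  then show "T (S f) = S (T f)" using \<open>f \<in> ell2 A\<close> by (simp add: compose_eq)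
qed

lemma commutant_unital_subalgebra:
  assumes X: "X \<subseteq> bounded_ops A"
  shows "unital_subalgebra A (commutant A X)"
proof -
  have Xf: "S f \<in> ell2 A" if "S \<in> X" "f \<in> ell2 A" for S f
    using bounded_ops_closed X that by blast
  note [simp] = Xf bounded_ops_closed[OF commutantD(1)] bounded_ops_add[OF subsetD[OF X]]
    bounded_ops_scale[OF subsetD[OF X]] commutantD(2)
  show ?thesis
    unfolding unital_subalgebra_def
  proof (intro conjI ballI allI)
    show "commutant A X \<subseteq> bounded_ops A" by (auto simp: commutant_def)
    show "(\<lambda>f\<in>ell2 A. f) \<in> commutant A X"
      by (rule commutantI[OF id_in_bounded_ops]) simp
    fix T assume T: "T \<in> commutant A X"
    show "(\<lambda>f\<in>ell2 A. \<lambda>x. c * T f x) \<in> commutant A X" for c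
      by (rule commutantI[OF scale_in_bounded_ops]) (use T in \<open>simp_all add: commutantD(1)\<close>)
    fix S assume S: "S \<in> commutant A X"
    show "(\<lambda>f\<in>ell2 A. \<lambda>x. S f x + T f x) \<in> commutant A X"
      by (rule commutantI[OF add_in_bounded_ops]) (use S T in \<open>simp_all add: commutantD(1)\<close>)
    show "compose (ell2 A) S T \<in> commutant A X"
      by (rule commutantI[OF compose_in_bounded_ops]) (use S T in \<open>simp_all add: commutantD(1) compose_def\<close>)
  qed
qed

text \<open>The commutant is an intersection of sets where two functionals of \<open>T\<close>
  agree. The entry of \<open>T (S f)\<close> at \<open>y\<close> is visibly WOT-continuous in
  \<open>T\<close>; that of \<open>S (T f)\<close> becomes so once the row of \<open>S\<close> turns
  it into an inner product with \<open>T f\<close>.\<close>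

lemma closedin_wot_commutant:
  assumes X: "X \<subseteq> bounded_ops A"
  shows "closedin (wot A) (commutant A X)"
proof -
  define E where "E = (\<lambda>(S, f, y). {T \<in> bounded_ops A. T (S f) y = S (T f) y})"
  have eq: "commutant A X = bounded_ops A \<inter> (\<Inter>i\<in>X \<times> ell2 A \<times> UNIV. E i)"
  proof (rule set_eqI)
    fix T
    show "T \<in> commutant A X \<longleftrightarrow> T \<in> bounded_ops A \<inter> (\<Inter>i\<in>X \<times> ell2 A \<times> UNIV. E i)"
      using commutantD[of T A X] commutantI[of T A X] by (auto simp: E_def fun_eq_iff)
  qed
  have cl: "closedin (wot A) (E (S, f, y))" if S: "S \<in> X" and f: "f \<in> ell2 A" for S f y
  proof -
    have Sb: "S \<in> bounded_ops A" using S X by blast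
    let ?r = "\<lambda>x. if x \<in> A then cnj (S (ket x) y) else 0"
    have "E (S, f, y) = {T \<in> topspace (wot A). T (S f) y = ell2_inner (T f) ?r}"
      using bounded_ops_row(2)[OF Sb bounded_ops_closed[OF _ f]] by (auto simp: E_def topspace_wot)
    moreover have "closedin (wot A) \<dots>"
    proof (cases "y \<in> A")
      case True
      have "closedin (wot A) {T \<in> topspace (wot A). ell2_inner (T (S f)) (ket y) = ell2_inner (T f) ?r}"
        by (rule closedin_continuous_maps_eq[of euclidean])
           (auto intro!: continuous_map_wot_inner bounded_ops_closed[OF Sb] f ket_in_ell2 True bounded_ops_row(1)[OF Sb])
      then show ?thesis by (simp add: ell2_inner_ket_right)
    next
      \<comment> \<open>Outside \<open>A\<close>, \<open>ket y\<close> is not an admissible test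
        vector, but both entries vanish and the condition is void.\<close>
      case False
      then have "T (S f) y = 0" "T f = T f \<and> S (T f) y = 0" if "T \<in> bounded_ops A" for T
        using bounded_ops_closed[OF that bounded_ops_closed[OF Sb f]]
          bounded_ops_closed[OF Sb bounded_ops_closed[OF that f]] by (auto simp: ell2_def)
      then have "{T \<in> topspace (wot A). T (S f) y = ell2_inner (T f) ?r} = topspace (wot A)"
        using bounded_ops_row(2)[OF Sb bounded_ops_closed[OF _ f]] by (auto simp: topspace_wot)
      then show ?thesis by simp
    qed
    ultimately show ?thesis by simp
  qed
  show ?thesis
  proof (cases "X = {}")
    case True
    then have "commutant A X = topspace (wot A)" by (simp add: commutant_def topspace_wot)
    then show ?thesis by simp
  next
    case False
    then have "X \<times> ell2 A \<times> UNIV \<noteq> {}" using zero_in_ell2 by blast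
    then have "closedin (wot A) (\<Inter>i\<in>X \<times> ell2 A \<times> UNIV. E i)"
      using cl by (intro closedin_INT) auto
    then show ?thesis unfolding eq topspace_wot[symmetric] by (intro closedin_Int) auto
  qed
qed

text \<open>The commutant is itself one of the algebras in the intersection that defines the
  generated one, so checking generators is enough.\<close>

lemma wot_algebra_generated_subset:
  assumes "Y \<subseteq> commutant A X" "X \<subseteq> bounded_ops A"
  shows "wot_algebra_generated A Y \<subseteq> commutant A X"
  using assms commutant_unital_subalgebra closedin_wot_commutant
  unfolding wot_algebra_generated_def by blast

lemma commutant_antimono: "X \<subseteq> Y \<Longrightarrow> commutant A Y \<subseteq> commutant A X"
  by (auto simp: commutant_def)

lemma commutant_sym:
  "X \<subseteq> commutant A Y \<Longrightarrow> Y \<subseteq> bounded_ops A \<Longrightarrow> Y \<subseteq> commutant A X"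
  unfolding commutant_def by fastforce

section \<open>Operators commuting with the left creation operators\<close>

abbreviation plen :: "('a, 'b) dpath \<Rightarrow> nat" where
  "plen w \<equiv> length (fst (snd w))"

lemma plen_pcomp: "plen (w \<cdot> v) = plen v + plen w"
  by (simp add: pcomp_def)

lemma vertex_path_in_dpaths: "w \<in> dpaths G \<Longrightarrow> vertex_path (source w) \<in> dpaths G"
  by (auto simp: vertex_path_def source_def dpaths_def pre_digraph.awalk_def pre_digraph.cas.simps)

lemma source_vertex_path [simp]: "source (vertex_path x) = x"
  and range_vertex_path [simp]: "range_of (vertex_path x) = x"
  by (simp_all add: vertex_path_def source_def range_of_def)

lemma pcomp_vertex_right: "w \<cdot> vertex_path (source w) = w"
  by (cases w) (simp add: pcomp_def vertex_path_def source_def range_of_def)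

lemma pcomp_vertex_left: "vertex_path (range_of w) \<cdot> w = w"
  by (cases w) (simp add: pcomp_def vertex_path_def source_def range_of_def)

lemma source_pcomp [simp]: "source (w \<cdot> v) = source v"
  and range_pcomp [simp]: "range_of (w \<cdot> v) = range_of w"
  by (simp_all add: pcomp_def source_def range_of_def)

lemma pcomp_assoc: "(w \<cdot> v) \<cdot> u = w \<cdot> (v \<cdot> u)"
  by (simp add: pcomp_def source_def range_of_def)

lemma range_of_unique:
  assumes "(x, p, y) \<in> dpaths G" "(x, p, z) \<in> dpaths G"
  shows "y = z"
proof -
  have "pre_digraph.cas G x p y \<Longrightarrow> pre_digraph.cas G x p z \<Longrightarrow> y = z" for x p
    by (induct p arbitrary: x) (auto simp: pre_digraph.cas.simps)
  then show ?thesis using assms by (auto simp: dpaths_def pre_digraph.awalk_def)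
qed

text \<open>The composite forgets the middle vertex: it shows the source and the arcs of
  \<open>u\<close>, and \<open>range_of_unique\<close> restores its range. Thus the coefficient
  index \<open>u\<close> can be read off from a composite once its length is known.\<close>

lemma pcomp_prefix_unique:
  assumes u: "u \<in> dpaths G" "u' \<in> dpaths G" and eq: "v \<cdot> u = v' \<cdot> u'" and len: "plen u = plen u'"
  shows "u = u'"
proof -
  obtain x p y x' p' y' where [simp]: "u = (x, p, y)" "u' = (x', p', y')"
    by (metis prod_cases3)
  have "x = x'" "p = p'" using eq len by (auto simp: pcomp_def source_def)
  then show ?thesis using u range_of_unique by simp
qed

section \<open>Formal series in the right creation operators\<close>

text \<open>
  A bounded operator with matrix entries \<open>\<alpha>(u) \<rho>(v,u)\<close> at \<open>(vu, v)\<close> and zero elsewhere is,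
  formally, \<open>\<Sum>\<^sub>u \<alpha>(u) R\<^sub>u\<close>.
\<close>

definition right_series ::
  "('a, 'b) pre_digraph \<Rightarrow> (('a, 'b) dpath \<Rightarrow> ('a, 'b) dpath \<Rightarrow> real) \<Rightarrow> (('a, 'b) dpath \<Rightarrow> complex) \<Rightarrow>
   ((('a, 'b) dpath \<Rightarrow> complex) \<Rightarrow> ('a, 'b) dpath \<Rightarrow> complex) \<Rightarrow> bool" where
  "right_series G rho \<alpha> T \<longleftrightarrow> T \<in> bounded_ops (dpaths G) \<and>
     (\<forall>v\<in>dpaths G. \<forall>u\<in>dpaths G. source v = range_of u \<longrightarrow> T (ket v) (v \<cdot> u) = \<alpha> u * of_real (rho v u)) \<and>
     (\<forall>v\<in>dpaths G. \<forall>y. (\<forall>u\<in>dpaths G. source v = range_of u \<longrightarrow> y \<noteq> v \<cdot> u) \<longrightarrow> T (ket v) y = 0)"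

lemma right_series_unique:
  assumes S: "right_series G rho \<alpha> S" and T: "right_series G rho \<alpha> T"
  shows "S = T"
proof (rule bounded_ops_eqI[of _ "dpaths G"])
  fix v assume v: "v \<in> dpaths G"
  show "S (ket v) = T (ket v)"
  proof
    fix y
    show "S (ket v) y = T (ket v) y"
    proof (cases "\<exists>u\<in>dpaths G. source v = range_of u \<and> y = v \<cdot> u")
      case True
      then show ?thesis using S T v by (auto simp: right_series_def)
    next
      case False
      then have "S (ket v) y = 0" "T (ket v) y = 0"
        using S T v unfolding right_series_def by blast+
      then show ?thesis by simp
    qed
  qed
qed (use S T in \<open>auto simp: right_series_def\<close>)

lemma right_series_sum:
  assumes "finite I" and T: "\<And>i. i \<in> I \<Longrightarrow> right_series G rho (\<alpha> i) (T i)"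
  shows "right_series G rho (\<lambda>u. \<Sum>i\<in>I. c i * \<alpha> i u) (\<lambda>f\<in>ell2 (dpaths G). \<lambda>x. \<Sum>i\<in>I. c i * T i f x)"
  unfolding right_series_def
proof (intro conjI ballI allI impI)
  have "unital_subalgebra (dpaths G) (bounded_ops (dpaths G))"
    by (simp add: unital_subalgebra_def id_in_bounded_ops add_in_bounded_ops scale_in_bounded_ops
        compose_in_bounded_ops)
  then show "(\<lambda>f\<in>ell2 (dpaths G). \<lambda>x. \<Sum>i\<in>I. c i * T i f x) \<in> bounded_ops (dpaths G)"
    using assms by (intro unital_subalgebra_sum) (auto simp: right_series_def)
next
  fix v u assume v: "v \<in> dpaths G" and u: "u \<in> dpaths G" "source v = range_of u"
  have "T i (ket v) (v \<cdot> u) = \<alpha> i u * of_real (rho v u)" if "i \<in> I" for i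
    using T[OF that] v u by (simp add: right_series_def)
  then show "(\<lambda>f\<in>ell2 (dpaths G). \<lambda>x. \<Sum>i\<in>I. c i * T i f x) (ket v) (v \<cdot> u)
      = (\<Sum>i\<in>I. c i * \<alpha> i u) * of_real (rho v u)"
    by (simp add: ket_in_ell2[OF v] sum_distrib_right mult.assoc)
next
  fix v y assume v: "v \<in> dpaths G" and y: "\<forall>u\<in>dpaths G. source v = range_of u \<longrightarrow> y \<noteq> v \<cdot> u"
  have "T i (ket v) y = 0" if "i \<in> I" for i
    using T[OF that] v y unfolding right_series_def by blast
  then show "(\<lambda>f\<in>ell2 (dpaths G). \<lambda>x. \<Sum>i\<in>I. c i * T i f x) (ket v) y = 0"
    by (simp add: ket_in_ell2[OF v])
qed

lemma right_series_R_op: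
  assumes rho: "right_weight G rho" and u: "u \<in> dpaths G" and fin: "weight_sup G rho u < \<infinity>"
  shows "right_series G rho (ket u) (R_op G rho u)"
  unfolding right_series_def
proof (intro conjI ballI allI impI)
  note R = R_op_spec[OF assms]
  show "R_op G rho u \<in> bounded_ops (dpaths G)" using R by blast
  fix v assume v: "v \<in> dpaths G"
  have Rv: "R_op G rho u (ket v) y = (if source v = range_of u then of_real (rho v u) * ket (v \<cdot> u) y else 0)" for y
    using R v by simp
  show "R_op G rho u (ket v) (v \<cdot> w) = ket u w * of_real (rho v w)" if "source v = range_of w" for w
    using that pcomp_inj_left[of v w u] unfolding Rv by (auto simp: ket_def)
  show "R_op G rho u (ket v) y = 0" if "\<forall>w\<in>dpaths G. source v = range_of w \<longrightarrow> y \<noteq> v \<cdot> w" for y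
    using that u unfolding Rv by (simp add: ket_def)
qed

text \<open>A matrix entry never exceeds the norm of the operator, and the entries belonging to
  \<open>u\<close> are \<alpha>(u) \<rho>(v,u) with \<alpha>(u) fixed.\<close>

lemma right_series_weight_finite:
  assumes rho: "right_weight G rho" and T: "right_series G rho \<alpha> T"
    and u: "u \<in> dpaths G" "\<alpha> u \<noteq> 0"
  shows "weight_sup G rho u < \<infinity>"
proof -
  have Tb: "T \<in> bounded_ops (dpaths G)" using T by (simp add: right_series_def)
  obtain C where C: "C \<ge> 0" "\<And>f. f \<in> ell2 (dpaths G) \<Longrightarrow> ell2_norm (T f) \<le> C * ell2_norm f"
    using bounded_ops_bound[OF Tb] by blast
  have "rho v u \<le> C / cmod (\<alpha> u)" if v: "v \<in> dpaths G" for v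
  proof (cases "source v = range_of u")
    case True
    have "cmod (\<alpha> u) * rho v u = cmod (T (ket v) (v \<cdot> u))"
      using T v u True rho by (auto simp: right_series_def norm_mult right_weight_def)
    also have "\<dots> \<le> C"
      using cmod_le_ell2_norm[OF bounded_ops_closed[OF Tb ket_in_ell2[OF v]], of "v \<cdot> u"]
        C(2)[OF ket_in_ell2[OF v]] by simp
    finally show ?thesis using u(2) by (simp add: field_simps)
  next
    case False
    \<comment> \<open>The supremum runs over all paths \<open>v\<close>, so the non-composable ones
      need a bound as well.\<close>
    then have "rho v u \<le> 0" using rho v u by (meson not_le right_weight_def)
    then show ?thesis using C(1) by (meson divide_nonneg_nonneg norm_ge_zero order_trans)
  qed
  then have "weight_sup G rho u \<le> ennreal (C / cmod (\<alpha> u))"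
    unfolding weight_sup_def by (intro SUP_least ennreal_leI)
  then show ?thesis by (simp add: order_le_less_trans)
qed

lemma right_series_finite_in_algebra:
  assumes rho: "right_weight G rho" and T: "right_series G rho \<alpha> T" and F: "finite F"
    and \<alpha>: "\<And>u. u \<in> dpaths G \<Longrightarrow> u \<notin> F \<Longrightarrow> \<alpha> u = 0"
    and M: "unital_subalgebra (dpaths G) M"
      "{R_op G rho u | u. u \<in> dpaths G \<and> weight_sup G rho u < \<infinity>} \<subseteq> M"
  shows "T \<in> M"
proof -
  \<comment> \<open>Paths with zero coefficient must be dropped: their weight may be infinite, and
    then \<open>R_op\<close> is an unspecified value that need not lie in \<open>M\<close>.\<close>
  define I where "I = {u \<in> F. u \<in> dpaths G \<and> \<alpha> u \<noteq> 0}"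
  have I: "finite I" using F by (simp add: I_def)
  have fin: "weight_sup G rho u < \<infinity>" if "u \<in> I" for u
    using right_series_weight_finite[OF rho T] that by (simp add: I_def)
  let ?S = "\<lambda>f\<in>ell2 (dpaths G). \<lambda>x. \<Sum>u\<in>I. \<alpha> u * R_op G rho u f x"
  have "right_series G rho (\<lambda>w. \<Sum>u\<in>I. \<alpha> u * ket u w) ?S"
    by (rule right_series_sum[OF I]) (use fin in \<open>auto intro: right_series_R_op[OF rho] simp: I_def\<close>)
  moreover have "(\<Sum>u\<in>I. \<alpha> u * ket u w) = \<alpha> w" if "w \<in> dpaths G" for w
  proof -
    have "(\<Sum>u\<in>I. \<alpha> u * ket u w) = (\<Sum>u\<in>I. if u = w then \<alpha> u else 0)"
      by (intro sum.cong) (auto simp: ket_def)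
    also have "\<dots> = (if w \<in> I then \<alpha> w else 0)" using I by (rule sum.delta)
    finally show ?thesis using \<alpha>[OF that] that by (auto simp: I_def)
  qed
  ultimately have "right_series G rho \<alpha> ?S" by (simp add: right_series_def)
  then have "T = ?S" by (rule right_series_unique[OF T])
  also have "?S \<in> M"
  proof (rule unital_subalgebra_sum[OF M(1) I])
    fix u assume "u \<in> I"
    then show "R_op G rho u \<in> M" using fin[of u] M(2) unfolding I_def by blast
  qed
  finally show ?thesis .
qed

section \<open>Cutoffs and limits of series\<close>

lemma right_series_homogeneous_part:
  assumes T: "right_series G rho \<alpha> T"
    and C: "C \<ge> 0" "\<And>f. f \<in> ell2 (dpaths G) \<Longrightarrow> ell2_norm (T f) \<le> C * ell2_norm f"
    and F: "F \<subseteq> dpaths G"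
  obtains S where "right_series G rho (\<lambda>u. if plen u = k \<and> u \<in> F then \<alpha> u else 0) S"
    "\<And>f. f \<in> ell2 (dpaths G) \<Longrightarrow> ell2_norm (S f) \<le> C * ell2_norm f"
proof -
  \<comment> \<open>The multiplier with \<open>n = 1\<close>: the blocks are sorted by the length
    \<open>m\<close> of the input and are pairwise disjoint. The output block keeps the composites
    whose initial segment of length \<open>k\<close> lies in \<open>F\<close>; by uniqueness of
    initial segments this is a condition on \<open>u\<close> alone.\<close>
  define P where "P m = {v :: ('a, 'b) dpath. plen v = m}" for m
  define B where "B m = {y. plen y = m + k \<and> (\<exists>u\<in>F. \<exists>v. plen u = k \<and> y = v \<cdot> u)}" for m
  have Tb: "T \<in> bounded_ops (dpaths G)" using T by (simp add: right_series_def)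
  have sub: "{m. x \<in> P m} \<subseteq> {plen x}" "{m. x \<in> B m} \<subseteq> {plen x - k}" for x
    by (auto simp: P_def B_def)
  have fin: "finite {m. x \<in> P m}" "finite {m. x \<in> B m}" for x
    by (rule finite_subset[OF sub(1)], simp, rule finite_subset[OF sub(2)], simp)
  have card: "card {m. x \<in> P m} \<le> 1" "card {m. x \<in> B m} \<le> 1" for x
    using card_mono[OF _ sub(1)[of x]] card_mono[OF _ sub(2)[of x]] by simp_all
  obtain S where S: "S \<in> bounded_ops (dpaths G)"
      "\<And>f. f \<in> ell2 (dpaths G) \<Longrightarrow> ell2_norm (S f) \<le> C * ell2_norm f"
      "\<And>v y. v \<in> dpaths G \<Longrightarrow> S (ket v) y = of_real (card {m. v \<in> P m \<and> y \<in> B m} / real 1) * T (ket v) y"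
    using schur_multiplier[OF Tb zero_less_one C fin(1) card(1) fin(2) card(2)] by blast
  have mult: "{m. v \<in> P m \<and> v \<cdot> u \<in> B m} = (if plen u = k \<and> u \<in> F then {plen v} else {})"
    if u: "u \<in> dpaths G" for u v
  proof -
    define Q where "Q \<longleftrightarrow> (\<exists>u'\<in>F. \<exists>v'. plen u' = k \<and> v \<cdot> u = v' \<cdot> u')"
    have "Q \<longleftrightarrow> u \<in> F" if "plen u = k"
      using pcomp_prefix_unique[OF u] F that unfolding Q_def by (metis subsetD)
    moreover have "v \<in> P m \<and> v \<cdot> u \<in> B m \<longleftrightarrow> plen v = m \<and> plen v + plen u = m + k \<and> Q" for m
      by (simp only: P_def B_def plen_pcomp mem_Collect_eq Q_def add.commute)
    ultimately show ?thesis by auto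
  qed
  have "right_series G rho (\<lambda>u. if plen u = k \<and> u \<in> F then \<alpha> u else 0) S"
    using T S(1) by (auto simp: right_series_def S(3) mult)
  then show thesis using S(2) by (rule that)
qed

lemma right_series_fejer_mean:
  assumes T: "right_series G rho \<alpha> T"
    and C: "C \<ge> 0" "\<And>f. f \<in> ell2 (dpaths G) \<Longrightarrow> ell2_norm (T f) \<le> C * ell2_norm f"
    and n: "n > 0"
  obtains S where "right_series G rho (\<lambda>u. of_real (real (n - plen u) / n) * \<alpha> u) S"
    "\<And>f. f \<in> ell2 (dpaths G) \<Longrightarrow> ell2_norm (S f) \<le> C * ell2_norm f"
proof -
  \<comment> \<open>Windows of \<open>n\<close> consecutive lengths, used for input and output
    alike. Paths whose lengths differ by \<open>plen u\<close> share exactly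
    \<open>n - plen u\<close> windows, with truncated subtraction, so the average has the triangular
    Fejer symbol.\<close>
  define P where "P m = {v :: ('a, 'b) dpath. plen v < m \<and> m \<le> plen v + n}" for m
  have Tb: "T \<in> bounded_ops (dpaths G)" using T by (simp add: right_series_def)
  have eq: "{m. x \<in> P m} = {plen x<..plen x + n}" for x
    by (auto simp: P_def)
  obtain S where S: "S \<in> bounded_ops (dpaths G)"
      "\<And>f. f \<in> ell2 (dpaths G) \<Longrightarrow> ell2_norm (S f) \<le> C * ell2_norm f"
      "\<And>v y. v \<in> dpaths G \<Longrightarrow> S (ket v) y = of_real (card {m. v \<in> P m \<and> y \<in> P m} / n) * T (ket v) y"
    using schur_multiplier[OF Tb n C, of P P] by (auto simp: eq)
  have mult: "card {m. v \<in> P m \<and> v \<cdot> u \<in> P m} = n - plen u" for u v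
  proof -
    have "{m. v \<in> P m \<and> v \<cdot> u \<in> P m} = {plen v + plen u<..plen v + n}"
      by (auto simp: P_def plen_pcomp)
    then show ?thesis by simp
  qed
  have "right_series G rho (\<lambda>u. of_real (real (n - plen u) / n) * \<alpha> u) S"
    using T S(1) by (auto simp: right_series_def S(3) mult mult.assoc)
  then show thesis using S(2) by (rule that)
qed

text \<open>Each matrix entry is one coefficient times a fixed weight, so under a common norm bound
  pointwise convergence of coefficients is all that WOT convergence requires.\<close>

lemma right_series_limit:
  assumes M: "closedin (wot (dpaths G)) M" and Fl: "Fl \<noteq> bot"
    and S: "\<And>i. right_series G rho (\<beta> i) (S i)" "\<And>i. S i \<in> M"
    and T: "right_series G rho \<alpha> T" and C: "C \<ge> 0"
    and SC: "\<And>i f. f \<in> ell2 (dpaths G) \<Longrightarrow> ell2_norm (S i f) \<le> C * ell2_norm f"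
    and TC: "\<And>f. f \<in> ell2 (dpaths G) \<Longrightarrow> ell2_norm (T f) \<le> C * ell2_norm f"
    and lim: "\<And>u. u \<in> dpaths G \<Longrightarrow> ((\<lambda>i. \<beta> i u) \<longlongrightarrow> \<alpha> u) Fl"
  shows "T \<in> M"
proof (rule wot_closed_bounded_limit[OF M Fl S(2) _ C SC TC])
  show "T \<in> bounded_ops (dpaths G)" using T by (simp add: right_series_def)
  fix v y assume v: "v \<in> dpaths G"
  show "((\<lambda>i. S i (ket v) y) \<longlongrightarrow> T (ket v) y) Fl"
  proof (cases "\<exists>u\<in>dpaths G. source v = range_of u \<and> y = v \<cdot> u")
    case True
    then obtain u where u: "u \<in> dpaths G" "source v = range_of u" "y = v \<cdot> u" by blast
    then have "S i (ket v) y = \<beta> i u * of_real (rho v u)" "T (ket v) y = \<alpha> u * of_real (rho v u)" for i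
      using S(1)[of i] T v by (simp_all add: right_series_def)
    then show ?thesis by (simp add: tendsto_mult_right lim[OF u(1)])
  next
    case False
    then have "S i (ket v) y = 0" "T (ket v) y = 0" for i
      using S(1)[of i] T v unfolding right_series_def by blast+
    then show ?thesis by simp
  qed
qed auto

text \<open>
  The homogeneous parts are limits of finite sums of multiples of the \<open>R\<^sub>u\<close>, and the series
  is the limit of its Fejer means, which are finite combinations of the homogeneous parts.
\<close>

lemma right_series_in_right_algebra:
  assumes rho: "right_weight G rho" and T: "right_series G rho \<alpha> T"
  shows "T \<in> right_algebra G rho"
  unfolding right_algebra_def wot_algebra_generated_def
proof (rule InterI, elim CollectE conjE)
  fix M
  assume M: "unital_subalgebra (dpaths G) M" "closedin (wot (dpaths G)) M"
    "{R_op G rho u | u. u \<in> dpaths G \<and> weight_sup G rho u < \<infinity>} \<subseteq> M"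
  have Tb: "T \<in> bounded_ops (dpaths G)" using T by (simp add: right_series_def)
  obtain C where C: "C \<ge> 0" "\<And>f. f \<in> ell2 (dpaths G) \<Longrightarrow> ell2_norm (T f) \<le> C * ell2_norm f"
    using bounded_ops_bound[OF Tb] by blast
  have "\<exists>H. right_series G rho (\<lambda>u. if plen u = k \<and> u \<in> dpaths G then \<alpha> u else 0) H \<and> H \<in> M" for k
  proof -
    obtain H where H: "right_series G rho (\<lambda>u. if plen u = k \<and> u \<in> dpaths G then \<alpha> u else 0) H"
      "\<And>f. f \<in> ell2 (dpaths G) \<Longrightarrow> ell2_norm (H f) \<le> C * ell2_norm f"
      using right_series_homogeneous_part[OF T C order_refl] by blast
    have "\<exists>S. right_series G rho (\<lambda>u. if plen u = k \<and> u \<in> F \<inter> dpaths G then \<alpha> u else 0) S \<and>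
        (\<forall>f\<in>ell2 (dpaths G). ell2_norm (S f) \<le> C * ell2_norm f)" for F
    proof (rule right_series_homogeneous_part[OF T C Int_lower2[of F "dpaths G"], of k])
      fix S assume "right_series G rho (\<lambda>u. if plen u = k \<and> u \<in> F \<inter> dpaths G then \<alpha> u else 0) S"
        "\<And>f. f \<in> ell2 (dpaths G) \<Longrightarrow> ell2_norm (S f) \<le> C * ell2_norm f"
      then show ?thesis by (intro exI[of _ S] conjI ballI)
    qed
    then have "\<forall>F. \<exists>S. right_series G rho (\<lambda>u. if plen u = k \<and> u \<in> F \<inter> dpaths G then \<alpha> u else 0) S \<and>
        (\<forall>f\<in>ell2 (dpaths G). ell2_norm (S f) \<le> C * ell2_norm f)" by (rule allI)
    from choice[OF this] obtain S0 where S0: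
      "\<forall>F. right_series G rho (\<lambda>u. if plen u = k \<and> u \<in> F \<inter> dpaths G then \<alpha> u else 0) (S0 F) \<and>
        (\<forall>f\<in>ell2 (dpaths G). ell2_norm (S0 F f) \<le> C * ell2_norm f)" by (elim exE)
    \<comment> \<open>Infinite index sets are irrelevant for the filter, but the limit lemma asks for
      all members of the net to lie in \<open>M\<close>.\<close>
    define c where "c F = (if finite F then F else {})" for F :: "('a, 'b) dpath set"
    define S where "S F = S0 (c F)" for F
    have S:
      "\<And>F. right_series G rho (\<lambda>u. if plen u = k \<and> u \<in> c F \<inter> dpaths G then \<alpha> u else 0) (S F)"
      "\<And>F f. f \<in> ell2 (dpaths G) \<Longrightarrow> ell2_norm (S F f) \<le> C * ell2_norm f"
      using S0 by (simp_all add: S_def)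
    have SM: "S F \<in> M" for F
      by (rule right_series_finite_in_algebra[OF rho S(1) _ _ M(1,3), of "c F"]) (auto simp: c_def)
    have "H \<in> M"
    proof (rule right_series_limit[OF M(2) finite_subsets_at_top_neq_bot S(1) SM H(1) C(1) S(2) H(2)])
      fix u :: "('a, 'b) dpath" assume u: "u \<in> dpaths G"
      have "\<forall>\<^sub>F F in finite_subsets_at_top UNIV. finite F \<and> u \<in> F"
        unfolding eventually_finite_subsets_at_top by (rule exI[of _ "{u}"]) auto
      then have "\<forall>\<^sub>F F in finite_subsets_at_top UNIV.
          (if plen u = k \<and> u \<in> c F \<inter> dpaths G then \<alpha> u else 0) = (if plen u = k \<and> u \<in> dpaths G then \<alpha> u else 0)"
        by eventually_elim (auto simp: c_def)
      then show "((\<lambda>F. if plen u = k \<and> u \<in> c F \<inter> dpaths G then \<alpha> u else 0)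
          \<longlongrightarrow> (if plen u = k \<and> u \<in> dpaths G then \<alpha> u else 0)) (finite_subsets_at_top UNIV)"
        by (rule tendsto_eventually)
    qed auto
    with H(1) show ?thesis by (intro exI[of _ H] conjI)
  qed
  then have "\<forall>k. \<exists>H. right_series G rho (\<lambda>u. if plen u = k \<and> u \<in> dpaths G then \<alpha> u else 0) H \<and> H \<in> M"
    by (rule allI)
  from choice[OF this] obtain H where H0:
    "\<forall>k. right_series G rho (\<lambda>u. if plen u = k \<and> u \<in> dpaths G then \<alpha> u else 0) (H k) \<and> H k \<in> M"
    by (elim exE)
  have H: "\<And>k. right_series G rho (\<lambda>u. if plen u = k \<and> u \<in> dpaths G then \<alpha> u else 0) (H k)"
    "\<And>k. H k \<in> M" using H0 by simp_all
  \<comment> \<open>\<open>Suc n\<close> keeps the order of the Fejer mean positive.\<close>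
  have "\<forall>n. \<exists>S. right_series G rho (\<lambda>u. of_real (real (Suc n - plen u) / Suc n) * \<alpha> u) S \<and>
      (\<forall>f\<in>ell2 (dpaths G). ell2_norm (S f) \<le> C * ell2_norm f)"
  proof
    fix n
    show "\<exists>S. right_series G rho (\<lambda>u. of_real (real (Suc n - plen u) / Suc n) * \<alpha> u) S \<and>
        (\<forall>f\<in>ell2 (dpaths G). ell2_norm (S f) \<le> C * ell2_norm f)"
    proof (rule right_series_fejer_mean[OF T C zero_less_Suc[of n]])
      fix S assume "right_series G rho (\<lambda>u. of_real (real (Suc n - plen u) / Suc n) * \<alpha> u) S"
        "\<And>f. f \<in> ell2 (dpaths G) \<Longrightarrow> ell2_norm (S f) \<le> C * ell2_norm f"
      then show ?thesis by (intro exI[of _ S] conjI ballI)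
    qed
  qed
  from choice[OF this] obtain S where S0:
    "\<forall>n. right_series G rho (\<lambda>u. of_real (real (Suc n - plen u) / Suc n) * \<alpha> u) (S n) \<and>
      (\<forall>f\<in>ell2 (dpaths G). ell2_norm (S n f) \<le> C * ell2_norm f)" by (elim exE)
  have S:
    "\<And>n. right_series G rho (\<lambda>u. of_real (real (Suc n - plen u) / Suc n) * \<alpha> u) (S n)"
    "\<And>n f. f \<in> ell2 (dpaths G) \<Longrightarrow> ell2_norm (S n f) \<le> C * ell2_norm f"
    using S0 by simp_all
  have SM: "S n \<in> M" for n
  proof -
    let ?c = "\<lambda>k. complex_of_real (real (Suc n - k) / Suc n)"
    let ?S = "\<lambda>f\<in>ell2 (dpaths G). \<lambda>x. \<Sum>k\<in>{..n}. ?c k * H k f x"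
    have "right_series G rho (\<lambda>u. \<Sum>k\<in>{..n}. ?c k * (if plen u = k \<and> u \<in> dpaths G then \<alpha> u else 0)) ?S"
      by (rule right_series_sum) (auto intro: H)
    moreover have "(\<Sum>k\<in>{..n}. ?c k * (if plen u = k \<and> u \<in> dpaths G then \<alpha> u else 0)) = ?c (plen u) * \<alpha> u"
      if "u \<in> dpaths G" for u
    proof -
      have "(\<Sum>k\<in>{..n}. ?c k * (if plen u = k \<and> u \<in> dpaths G then \<alpha> u else 0))
          = (\<Sum>k\<in>{..n}. if plen u = k then ?c k * \<alpha> u else 0)"
        using that by (intro sum.cong) auto
      also have "\<dots> = (if plen u \<in> {..n} then ?c (plen u) * \<alpha> u else 0)" by (rule sum.delta') simp
      finally show ?thesis by (auto simp: not_le)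
    qed
    ultimately have "right_series G rho (\<lambda>u. ?c (plen u) * \<alpha> u) ?S" by (simp add: right_series_def)
    \<comment> \<open>The Fejer mean was obtained only as a bounded operator. It has the same
      coefficients as the finite combination of homogeneous parts, since its weights vanish at
      lengths above \<open>n\<close>; uniqueness of the series then places it in
      \<open>M\<close>.\<close>
    then have "S n = ?S" by (rule right_series_unique[OF S(1)])
    also have "?S \<in> M" by (rule unital_subalgebra_sum[OF M(1)]) (auto intro: H)
    finally show ?thesis .
  qed
  show "T \<in> M"
  proof (rule right_series_limit[OF M(2) _ S(1) SM T C(1) S(2) C(2)])
    fix u :: "('a, 'b) dpath"
    have "(\<lambda>n. 1 - real (plen u) / real (Suc n)) \<longlonglongrightarrow> 1 - 0"
      by (intro tendsto_diff tendsto_const LIMSEQ_Suc[OF lim_const_over_n])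
    moreover have "\<forall>\<^sub>F n in sequentially. 1 - real (plen u) / Suc n = real (Suc n - plen u) / Suc n"
      using eventually_ge_at_top[of "plen u"] by eventually_elim (simp add: field_simps of_nat_diff)
    ultimately have "(\<lambda>n. real (Suc n - plen u) / Suc n) \<longlonglongrightarrow> 1"
      by (simp add: tendsto_cong)
    then have "(\<lambda>n. of_real (real (Suc n - plen u) / Suc n) * \<alpha> u) \<longlonglongrightarrow> of_real 1 * \<alpha> u"
      by (intro tendsto_intros)
    then show "(\<lambda>n. of_real (real (Suc n - plen u) / Suc n) * \<alpha> u) \<longlonglongrightarrow> \<alpha> u" by simp
  qed auto
qed

section \<open>Left creation operators and the two inclusions\<close>

text \<open>\<open>L_op\<close> is specified on kets only, but it will act on vectors
  \<open>T (ket x)\<close> of infinite support. Composition with \<open>w\<close> is injective, so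
  each row of its matrix has at most one nonzero entry and the row formula collapses to a single
  term.\<close>

lemma L_op_apply:
  assumes lam: "left_weight G lam" and w: "w \<in> dpaths G" and fin: "weight_sup G lam w < \<infinity>"
    and h: "h \<in> ell2 (dpaths G)"
  shows "u \<in> dpaths G \<Longrightarrow> source w = range_of u \<Longrightarrow> L_op G lam w h (w \<cdot> u) = of_real (lam u w) * h u"
    and "(\<And>u. u \<in> dpaths G \<Longrightarrow> source w = range_of u \<Longrightarrow> y \<noteq> w \<cdot> u) \<Longrightarrow> L_op G lam w h y = 0"
proof -
  note L = L_op_spec[OF lam w fin]
  have row: "L_op G lam w h y
      = ell2_inner h (\<lambda>x. if x \<in> dpaths G then cnj (L_op G lam w (ket x) y) else 0)" for y
    by (rule bounded_ops_row(2)) (use L h in auto)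
  show "L_op G lam w h (w \<cdot> u) = of_real (lam u w) * h u"
    if u: "u \<in> dpaths G" "source w = range_of u"
  proof -
    have "(\<lambda>x. if x \<in> dpaths G then cnj (L_op G lam w (ket x) (w \<cdot> u)) else 0)
        = cut {u} (\<lambda>x. of_real (lam u w))"
    proof
      fix x
      have "w \<cdot> u = w \<cdot> x \<longleftrightarrow> u = x" if "source w = range_of x"
        using pcomp_inj_left[OF u(2) that] by auto
      then show "(if x \<in> dpaths G then cnj (L_op G lam w (ket x) (w \<cdot> u)) else 0)
          = cut {u} (\<lambda>x. of_real (lam u w)) x"
        using L u by (auto simp: cut_def ket_def)
    qed
    then show ?thesis unfolding row by (simp add: ell2_inner_cut_right)
  qed
  show "L_op G lam w h y = 0" if "\<And>u. u \<in> dpaths G \<Longrightarrow> source w = range_of u \<Longrightarrow> y \<noteq> w \<cdot> u"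
  proof -
    have "(\<lambda>x. if x \<in> dpaths G then cnj (L_op G lam w (ket x) y) else 0) = (\<lambda>x. 0)"
      using L that by (auto simp: ket_def)
    then show ?thesis unfolding row by (simp add: ell2_inner_def)
  qed
qed

text \<open>On \<open>ket v\<close> both products give a multiple of the ket of the threefold
  composite, or zero under the same composability conditions; the companion identity says precisely
  that the two scalars agree.\<close>

lemma L_op_R_op_commute:
  assumes lam: "left_weight G lam" and w: "w \<in> dpaths G" "weight_sup G lam w < \<infinity>"
    and rho: "right_companion G lam rho" and u: "u \<in> dpaths G" "weight_sup G rho u < \<infinity>"
  shows "compose (ell2 (dpaths G)) (L_op G lam w) (R_op G rho u)
       = compose (ell2 (dpaths G)) (R_op G rho u) (L_op G lam w)"
proof -
  have rw: "right_weight G rho" using rho by (simp add: right_companion_def)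
  note L = L_op_spec[OF lam w] and R = R_op_spec[OF rw u]
  have Lb: "L_op G lam w \<in> bounded_ops (dpaths G)" and Rb: "R_op G rho u \<in> bounded_ops (dpaths G)"
    using L R by auto
  have zero: "S (\<lambda>x. 0) = (\<lambda>x. 0)" if "S \<in> bounded_ops (dpaths G)" for S
    using bounded_ops_scale[OF that zero_in_ell2, of 0] by simp
  show ?thesis
  proof (rule bounded_ops_eqI[OF compose_in_bounded_ops[OF Lb Rb] compose_in_bounded_ops[OF Rb Lb]])
    fix v assume v: "v \<in> dpaths G"
    have wv: "w \<cdot> v \<in> dpaths G" if "source w = range_of v"
      using that pcomp_in_dpaths_iff[OF v w(1)] by simp
    have vu: "v \<cdot> u \<in> dpaths G" if "source v = range_of u"
      using that pcomp_in_dpaths_iff[OF u(1) v] by simp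
    have LR: "L_op G lam w (R_op G rho u (ket v)) =
        (if source v = range_of u \<and> source w = range_of v
         then (\<lambda>x. of_real (rho v u * lam (v \<cdot> u) w) * ket (w \<cdot> v \<cdot> u) x) else (\<lambda>x. 0))"
      using R L v vu bounded_ops_scale[OF Lb ket_in_ell2[OF vu]] by (auto simp: zero[OF Lb] mult.assoc)
    have RL: "R_op G rho u (L_op G lam w (ket v)) =
        (if source v = range_of u \<and> source w = range_of v
         then (\<lambda>x. of_real (lam v w * rho (w \<cdot> v) u) * ket (w \<cdot> v \<cdot> u) x) else (\<lambda>x. 0))"
      using R L v wv bounded_ops_scale[OF Rb ket_in_ell2[OF wv]]
      by (auto simp: zero[OF Rb] mult.assoc pcomp_assoc)
    have "rho v u * lam (v \<cdot> u) w = lam v w * rho (w \<cdot> v) u"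
      if "source v = range_of u" "source w = range_of v"
      using rho v w(1) u(1) that by (simp add: right_companion_def mult.commute)
    then show "compose (ell2 (dpaths G)) (L_op G lam w) (R_op G rho u) (ket v)
        = compose (ell2 (dpaths G)) (R_op G rho u) (L_op G lam w) (ket v)"
      using LR RL ket_in_ell2[OF v] by (auto simp: compose_def)
  qed
qed

lemma commutant_imp_right_series:
  fixes G :: "('a, 'b) pre_digraph"
  assumes lam: "left_weight G lam" and bdd: "left_bounded G lam"
    and rho: "right_companion G lam rho"
    and T: "T \<in> commutant (dpaths G) {L_op G lam w | w. w \<in> dpaths G \<and> weight_sup G lam w < \<infinity>}"
  shows "right_series G rho
    (\<lambda>u. T (ket (vertex_path (range_of u))) u / of_real (rho (vertex_path (range_of u)) u)) T"
    (is "right_series G rho ?\<alpha> T")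
  unfolding right_series_def
proof (intro conjI ballI allI impI)
  show Tb: "T \<in> bounded_ops (dpaths G)" by (rule commutantD(1)[OF T])
  fix v assume v: "v \<in> dpaths G"
  define x :: "('a, 'b) dpath" where "x = vertex_path (source v)"
  have x: "x \<in> dpaths G" "range_of x = source v" "source x = source v" "v \<cdot> x = v"
    using vertex_path_in_dpaths[OF v] by (simp_all add: x_def pcomp_vertex_right)
  \<comment> \<open>Left-boundedness enters here: \<open>T\<close> commutes with
    \<open>L_op G lam v\<close> for every path \<open>v\<close>.\<close>
  have fin: "weight_sup G lam v < \<infinity>" using bdd v by (simp add: left_bounded_def)
  note L = L_op_spec[OF lam v fin]
  have pos: "lam x v > 0" using lam v x by (simp add: left_weight_def)
  have "T (L_op G lam v (ket x)) = L_op G lam v (T (ket x))"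
    by (rule commutantD(2)[OF T _ ket_in_ell2[OF x(1)]]) (use v fin in blast)
  moreover have "L_op G lam v (ket x) = (\<lambda>y. of_real (lam x v) * ket v y)"
    using L x by simp
  ultimately have key: "of_real (lam x v) * T (ket v) y = L_op G lam v (T (ket x)) y" for y
    using bounded_ops_scale[OF Tb ket_in_ell2[OF v]] by metis
  note La = L_op_apply[OF lam v fin bounded_ops_closed[OF Tb ket_in_ell2[OF x(1)]]]
  show "T (ket v) (v \<cdot> u) = ?\<alpha> u * of_real (rho v u)"
    if u: "u \<in> dpaths G" and comp: "source v = range_of u" for u
  proof -
    have xu: "x \<cdot> u = u" "x = vertex_path (range_of u)"
      using comp by (simp_all add: x_def pcomp_vertex_left)
    \<comment> \<open>The companion identity with the vertex \<open>x\<close> as middle path. Both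
      composites with \<open>x\<close> collapse, which trades the left weight of \<open>v\<close> at
      \<open>u\<close> for the right weight of \<open>u\<close> at \<open>v\<close>, up to factors
      based at \<open>x\<close>.\<close>
    have "rho (v \<cdot> x) u * lam x v = lam (x \<cdot> u) v * rho x u"
      using rho v x u comp unfolding right_companion_def by metis
    then have r: "rho v u * lam x v = lam u v * rho x u" by (simp add: x(4) xu(1))
    have rpos: "rho x u > 0"
      using rho x u comp by (simp add: right_companion_def right_weight_def)
    have "of_real (lam x v) * T (ket v) (v \<cdot> u) = of_real (lam u v) * T (ket x) u"
      using key La(1)[OF u comp] by simp
    also have "\<dots> = of_real (lam u v * rho x u) * ?\<alpha> u"
      using rpos by (simp add: xu(2)[symmetric])
    also have "\<dots> = of_real (lam x v) * (?\<alpha> u * of_real (rho v u))"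
      by (simp only: r[symmetric] of_real_mult mult_ac)
    finally show ?thesis
      by (rule mult_left_cancel[THEN iffD1, rotated]) (use pos in simp)
  qed
  \<comment> \<open>Everything in the range of \<open>L_op G lam v\<close> is supported on
    composites ending with \<open>v\<close>, and the factor \<open>lam x v\<close> is
    nonzero.\<close>
  show "T (ket v) y = 0" if "\<forall>u\<in>dpaths G. source v = range_of u \<longrightarrow> y \<noteq> v \<cdot> u" for y
    using key[of y] La(2)[of y] that pos by auto
qed

theorem theorem3p7:
  fixes G :: "('a, 'b) pre_digraph"
    and lam rho :: "('a, 'b) dpath \<Rightarrow> ('a, 'b) dpath \<Rightarrow> real"
  assumes "wf_digraph G" and "countable (verts G)" and "countable (arcs G)"
    and "left_weight G lam" and "left_bounded G lam"
    and "canonical_right_companion G lam rho"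
  shows "commutant (dpaths G) (left_algebra G lam) = right_algebra G rho"
proof
  let ?A = "dpaths G"
  let ?L = "{L_op G lam w | w. w \<in> dpaths G \<and> weight_sup G lam w < \<infinity>}"
  let ?R = "{R_op G rho u | u. u \<in> dpaths G \<and> weight_sup G rho u < \<infinity>}"
  have comp: "right_companion G lam rho" and rw: "right_weight G rho"
    using assms(6) by (simp_all add: canonical_right_companion_def right_companion_def)
  have "?L \<subseteq> left_algebra G lam"
    unfolding left_algebra_def wot_algebra_generated_def by blast
  then have "commutant ?A (left_algebra G lam) \<subseteq> commutant ?A ?L"
    by (rule commutant_antimono)
  also have "\<dots> \<subseteq> right_algebra G rho"
    using right_series_in_right_algebra[OF rw commutant_imp_right_series[OF assms(4,5) comp]] by blast
  finally show "commutant ?A (left_algebra G lam) \<subseteq> right_algebra G rho" .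
  have Rb: "?R \<subseteq> bounded_ops ?A" using R_op_spec[OF rw] by blast
  have "?L \<subseteq> commutant ?A ?R"
    using L_op_spec[OF assms(4)] L_op_R_op_commute[OF assms(4) _ _ comp]
    unfolding commutant_def by blast
  \<comment> \<open>Commutation of generators is extended one side at a time: to the whole left
    algebra against the generators \<open>?R\<close>, then, with the roles exchanged, to the whole
    right algebra.\<close>
  then have LR: "left_algebra G lam \<subseteq> commutant ?A ?R"
    unfolding left_algebra_def by (rule wot_algebra_generated_subset[OF _ Rb])
  then have "left_algebra G lam \<subseteq> bounded_ops ?A"
    by (auto simp: commutant_def)
  then show "right_algebra G rho \<subseteq> commutant ?A (left_algebra G lam)"
    unfolding right_algebra_def
    by (rule wot_algebra_generated_subset[OF commutant_sym[OF LR Rb]])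
qed

end
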